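(* Let $V:\mathbb{R}\to\mathbb{C}$ lie in $L^1(\mathbb{R})\cap L^2(\mathbb{R})$ and satisfy $$\int_{\mathbb{R}}|V(x)|e^{\gamma x}\,dx<\infty\qquad\text{for all }\gamma\in\mathbb{R}.$$ Let $H=-\frac{d^2}{dx^2}+V$ act in $L^2(\mathbb{R})$ with domain $W^{2,2}(\mathbb{R})$. Then the number of eigenvalues of $H$ is finite, and all the eigenvalues $\lambda$ of $H$ (including real ones) satisfy $$|\lambda|\le\frac{9}{4}\|V\|_1^2.$$
   Context: $\|V\|_1=\int_{\mathbb{R}}|V(x)|\,dx$. *)

theory Defs
  imports "HOL-Analysis.Analysis"
begin

text \<open>Elements of Lebesgue and Sobolev spaces are represented by functions; identities between
  them (including being nonzero) are read almost everywhere.\<close>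

definition L1_space :: "(real \<Rightarrow> complex) set" where
  "L1_space = {f. integrable lebesgue f}"

definition L2_space :: "(real \<Rightarrow> complex) set" where
  "L2_space = {f. f \<in> borel_measurable lebesgue \<and> integrable lebesgue (\<lambda>x. (cmod (f x))\<^sup>2)}"

definition L1_norm :: "(real \<Rightarrow> complex) \<Rightarrow> real" where
  "L1_norm f = (\<integral>x. cmod (f x) \<partial>lebesgue)"

definition test_function :: "(real \<Rightarrow> real) \<Rightarrow> bool" where
  "test_function \<phi> \<longleftrightarrow>
     (\<forall>n. (deriv ^^ n) \<phi> differentiable_on UNIV) \<and> compact (closure {x. \<phi> x \<noteq> 0})"

definition locally_integrable :: "(real \<Rightarrow> complex) \<Rightarrow> bool" where
  "locally_integrable f \<longleftrightarrow> (\<forall>K. compact K \<longrightarrow> f absolutely_integrable_on K)"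

definition has_weak_deriv :: "nat \<Rightarrow> (real \<Rightarrow> complex) \<Rightarrow> (real \<Rightarrow> complex) \<Rightarrow> bool" where
  "has_weak_deriv k f g \<longleftrightarrow> locally_integrable f \<and> locally_integrable g \<and>
     (\<forall>\<phi>. test_function \<phi> \<longrightarrow>
        (\<integral>x. f x * of_real ((deriv ^^ k) \<phi> x) \<partial>lebesgue) =
        (-1) ^ k * (\<integral>x. g x * of_real (\<phi> x) \<partial>lebesgue))"

text \<open>The weak derivative is unique up to null sets, so the choice of representative is
  immaterial.\<close>

definition weak_deriv :: "nat \<Rightarrow> (real \<Rightarrow> complex) \<Rightarrow> real \<Rightarrow> complex" where
  "weak_deriv k f = (SOME g. has_weak_deriv k f g)"

text \<open>The Sobolev space \<open>W\<^sup>k\<^sup>,\<^sup>2\<close> of the real line.\<close>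

definition W2_space :: "nat \<Rightarrow> (real \<Rightarrow> complex) set" where
  "W2_space k = {f \<in> L2_space. \<forall>j\<le>k. \<exists>g\<in>L2_space. has_weak_deriv j f g}"

text \<open>The action of \<open>- d\<^sup>2/dx\<^sup>2 + V\<close>, meaningful on \<open>W2_space 2\<close>.\<close>

definition schrodinger :: "(real \<Rightarrow> complex) \<Rightarrow> (real \<Rightarrow> complex) \<Rightarrow> real \<Rightarrow> complex" where
  "schrodinger V f = (\<lambda>x. - weak_deriv 2 f x + V x * f x)"

definition eigenvalues ::
    "(real \<Rightarrow> complex) set \<Rightarrow> ((real \<Rightarrow> complex) \<Rightarrow> real \<Rightarrow> complex) \<Rightarrow> complex set" where
  "eigenvalues D T = {z. \<exists>f\<in>D. \<not> (AE x in lebesgue. f x = 0) \<and>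
                                 (AE x in lebesgue. T f x = z * f x)}"

end

theory Submission
  imports Defs "HOL-Complex_Analysis.Complex_Analysis"
begin

text \<open>Write an eigenvalue \<open>z \<noteq> 0\<close> as \<open>k\<^sup>2\<close> with \<open>Im k \<ge> 0\<close>. Mollifying the weak equation and
  integrating it classically shows that an eigenfunction \<open>F\<close> satisfies
  \<open>2ik F(x) = \<integral> e\<^sup>i\<^sup>k\<^sup>|\<^sup>x\<^sup>-\<^sup>s\<^sup>| V(s) F(s) ds\<close>, even for real \<open>k\<close>. Taking suprema gives
  \<open>|k| \<le> \<parallel>V\<parallel>\<^sub>1 / 2\<close>, so that in fact \<open>|z| \<le> \<parallel>V\<parallel>\<^sub>1\<^sup>2 / 4\<close>.

  The function \<open>M(x) = e\<^sup>-\<^sup>i\<^sup>k\<^sup>x F(x)\<close> solves a Volterra equation \<open>M = A + T\<^sub>k M\<close> with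
  \<open>2ik A = \<integral> V M\<close>; iterating it yields \<open>M = A \<Sum> T\<^sub>k\<^sup>n 1\<close>, hence \<open>k\<close> is a zero of the Jost function
  \<open>J(k) = 2ik - \<Sum> \<integral> V T\<^sub>k\<^sup>n 1\<close>. Super-exponential decay of \<open>V\<close> makes \<open>J\<close> holomorphic on every disc,
  including the part in the lower half-plane, and \<open>J\<close> does not vanish high up on the imaginary axis.
  So \<open>J\<close> has finitely many zeros in the compact disc \<open>|k| \<le> \<parallel>V\<parallel>\<^sub>1 / 2\<close>.\<close>

subsection \<open>Smooth cut-off functions\<close>

text \<open>Real \<open>k\<close> shape the proof. They bound the upper half-plane, the kernel has
  no decay there, and eigenvalues could a priori accumulate towards them; counting zeros inside the
  open half-plane would not exclude this. So \<open>J\<close> is continued past the real axis, where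
  \<open>exp (2 * i * k * y)\<close> grows with \<open>y\<close>, and the exponential moments of
  \<open>V\<close> pay for that growth through a weight that increases towards minus infinity.

  The integral equation is of Fredholm type, and its Neumann series need not converge for small
  \<open>k\<close>. Once the factor \<open>exp (i * k * x)\<close> is split off, its kernel is the
  constant 1 plus a Volterra part. A single unknown number \<open>A\<close> then separates the
  solution from a Volterra series that converges on the whole disc, and eliminating \<open>A\<close>
  leaves one scalar holomorphic condition instead of an operator determinant.

  Division by \<open>k\<close> excludes the eigenvalue 0. It is treated apart: one more point
  preserves finiteness and satisfies every bound of this kind.\<close>

definition smooth :: "(real \<Rightarrow> real) \<Rightarrow> bool" where
  "smooth f \<longleftrightarrow> (\<forall>n. (deriv ^^ n) f differentiable_on UNIV)"

text \<open>Stratifying smoothness by order lets the product rule be proved by induction.\<close>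

fun diff_upto :: "nat \<Rightarrow> (real \<Rightarrow> real) \<Rightarrow> bool" where
  "diff_upto 0 f \<longleftrightarrow> f differentiable_on UNIV"
| "diff_upto (Suc n) f \<longleftrightarrow> f differentiable_on UNIV \<and> diff_upto n (deriv f)"

lemma diff_upto_imp_differentiable: "diff_upto n f \<Longrightarrow> f differentiable_on UNIV"
  by (cases n) auto

lemma diff_upto_SucD: "diff_upto (Suc n) f \<Longrightarrow> diff_upto n f"
  by (induction n arbitrary: f) (auto dest: diff_upto_imp_differentiable)

lemma diff_upto_iff: "diff_upto n f \<longleftrightarrow> (\<forall>m\<le>n. (deriv ^^ m) f differentiable_on UNIV)"
proof (induction n arbitrary: f)
  case (Suc n)
  have "(\<forall>m\<le>Suc n. (deriv ^^ m) f differentiable_on UNIV) \<longleftrightarrow>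
        f differentiable_on UNIV \<and> (\<forall>m\<le>n. (deriv ^^ Suc m) f differentiable_on UNIV)"
    by (metis Suc_le_mono bot_nat_0.extremum funpow_0 not0_implies_Suc)
  then show ?case by (simp add: Suc.IH funpow_swap1)
qed auto

lemma smooth_iff: "smooth f \<longleftrightarrow> (\<forall>n. diff_upto n f)"
  unfolding smooth_def diff_upto_iff by auto

lemma differentiable_on_UNIV_DERIV:
  fixes f :: "real \<Rightarrow> real"
  assumes "f differentiable_on UNIV"
  shows "(f has_real_derivative deriv f x) (at x)"
  using assms unfolding differentiable_on_def
  by (metis DERIV_deriv_iff_real_differentiable UNIV_I)

lemma differentiable_on_UNIV_I:
  fixes f :: "real \<Rightarrow> real"
  assumes "\<And>x. (f has_real_derivative f' x) (at x)"
  shows "f differentiable_on UNIV" and "deriv f = f'"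
  using assms real_differentiable_def by (auto simp: differentiable_on_def DERIV_imp_deriv)

lemma diff_upto_add: "diff_upto n f \<Longrightarrow> diff_upto n g \<Longrightarrow> diff_upto n (\<lambda>x. f x + g x)"
proof (induction n arbitrary: f g)
  case 0
  then show ?case by (auto intro: differentiable_on_add)
next
  case (Suc n)
  have "((\<lambda>x. f x + g x) has_real_derivative deriv f x + deriv g x) (at x)" for x
    using Suc.prems by (auto intro!: derivative_intros differentiable_on_UNIV_DERIV)
  from differentiable_on_UNIV_I[OF this] show ?case using Suc by auto
qed

lemma diff_upto_mult: "diff_upto n f \<Longrightarrow> diff_upto n g \<Longrightarrow> diff_upto n (\<lambda>x. f x * g x)"
proof (induction n arbitrary: f g)
  case 0
  then show ?case by (auto intro: differentiable_on_mult)
next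
  case (Suc n)
  have "((\<lambda>x. f x * g x) has_real_derivative f x * deriv g x + deriv f x * g x) (at x)" for x
    using Suc.prems
    by (auto intro!: derivative_eq_intros differentiable_on_UNIV_DERIV)
  from differentiable_on_UNIV_I[OF this] show ?case
    using Suc.prems diff_upto_SucD by (auto intro!: diff_upto_add Suc.IH)
qed

lemma smooth_mult: "smooth f \<Longrightarrow> smooth g \<Longrightarrow> smooth (\<lambda>x. f x * g x)"
  by (simp add: smooth_iff diff_upto_mult)

lemma smooth_DERIV: "smooth f \<Longrightarrow> (f has_real_derivative deriv f x) (at x)"
  unfolding smooth_iff using diff_upto_imp_differentiable differentiable_on_UNIV_DERIV by blast

lemma smooth_deriv: "smooth f \<Longrightarrow> smooth (deriv f)"
  by (metis diff_upto.simps(2) smooth_iff)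

lemma smooth_affine_deriv:
  assumes "smooth f"
  shows "(deriv ^^ n) (\<lambda>x. f (a + b * x)) = (\<lambda>x. b ^ n * (deriv ^^ n) f (a + b * x))"
    and "smooth (\<lambda>x. f (a + b * x))"
proof -
  have D: "((\<lambda>x. b ^ n * (deriv ^^ n) f (a + b * x)) has_real_derivative
       b ^ Suc n * (deriv ^^ Suc n) f (a + b * x)) (at x)" for n x
  proof -
    have "smooth ((deriv ^^ n) f)"
      by (induction n) (auto simp: assms smooth_deriv)
    moreover have "((\<lambda>x. a + b * x) has_real_derivative b) (at x)"
      by (auto intro!: derivative_eq_intros)
    ultimately have "((\<lambda>x. (deriv ^^ n) f (a + b * x)) has_real_derivative
           deriv ((deriv ^^ n) f) (a + b * x) * b) (at x)"
      by (intro DERIV_chain2[OF smooth_DERIV])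
    from DERIV_cmult[OF this, of "b ^ n"] show ?thesis by (simp add: mult_ac)
  qed
  have *: "(deriv ^^ n) (\<lambda>x. f (a + b * x)) = (\<lambda>x. b ^ n * (deriv ^^ n) f (a + b * x))" for n
  proof (induction n)
    case (Suc n)
    show ?case using differentiable_on_UNIV_I(2)[OF D, of n] by (simp add: Suc)
  qed auto
  then show "(deriv ^^ n) (\<lambda>x. f (a + b * x)) = (\<lambda>x. b ^ n * (deriv ^^ n) f (a + b * x))" .
  show "smooth (\<lambda>x. f (a + b * x))"
    unfolding smooth_def * using differentiable_on_UNIV_I(1)[OF D] by blast
qed

text \<open>The classical flat function is the case \<open>p = 1\<close>. The polynomial factor
  closes the family under differentiation: with \<open>y = 1 / x\<close> the derivative replaces
  \<open>p\<close> by \<open>y^2 * (p - p')\<close>. Smoothness is then a single induction over all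
  \<open>p\<close>.\<close>

definition exp_cutoff :: "real poly \<Rightarrow> real \<Rightarrow> real" where
  "exp_cutoff p x = (if x > 0 then poly p (1 / x) * exp (- 1 / x) else 0)"

lemma tendsto_poly_div_exp: "((\<lambda>y::real. poly p y * exp (- y)) \<longlongrightarrow> 0) at_top"
proof -
  have "((\<lambda>y::real. \<Sum>i\<le>degree p. coeff p i * (y ^ i / exp y)) \<longlongrightarrow> (\<Sum>i\<le>degree p. coeff p i * 0)) at_top"
    by (intro tendsto_intros tendsto_power_div_exp_0)
  then show ?thesis
    by (simp add: poly_altdef sum_distrib_right exp_minus divide_inverse mult.assoc)
qed

lemma exp_cutoff_DERIV:
  "(exp_cutoff p has_real_derivative exp_cutoff ([:0, 0, 1:] * (p - pderiv p)) x) (at x)"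
proof -
  consider "x < 0" | "x = 0" | "x > 0" by linarith
  then show ?thesis
  proof cases
    case 1
    have "((\<lambda>_. 0) has_real_derivative 0) (at x)" by simp
    then have "(exp_cutoff p has_real_derivative 0) (at x)"
      by (rule has_field_derivative_transform_within_open[where S = "{..<0}"])
         (use 1 in \<open>auto simp: exp_cutoff_def\<close>)
    then show ?thesis using 1 by (simp add: exp_cutoff_def)
  next
    case 3
    have "((\<lambda>x. poly p (1 / x) * exp (- 1 / x)) has_real_derivative
           poly ([:0, 0, 1:] * (p - pderiv p)) (1 / x) * exp (- 1 / x)) (at x)"
      using 3
      by (auto intro!: derivative_eq_intros DERIV_chain2[OF poly_DERIV]
               simp: field_simps power2_eq_square)
    then have "(exp_cutoff p has_real_derivative
        poly ([:0, 0, 1:] * (p - pderiv p)) (1 / x) * exp (- 1 / x)) (at x)"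
      by (rule has_field_derivative_transform_within_open[where S = "{0<..}"])
         (use 3 in \<open>auto simp: exp_cutoff_def\<close>)
    then show ?thesis using 3 by (simp add: exp_cutoff_def)
  next
    case 2
    have "((\<lambda>y. exp_cutoff p y / y) \<longlongrightarrow> 0) (at_left 0)"
      by (rule tendsto_eventually) (auto simp: exp_cutoff_def eventually_at_filter)
    moreover have "((\<lambda>y. exp_cutoff p y / y) \<longlongrightarrow> 0) (at_right 0)"
    proof -
      \<comment> \<open>Dividing by the variable multiplies the polynomial in the reciprocal by one
        more linear factor, hence \<open>[:0, 1:] * p\<close>.\<close>
      have "((\<lambda>y. poly ([:0, 1:] * p) (inverse y) * exp (- inverse y)) \<longlongrightarrow> 0) (at_right (0::real))"
        by (rule filterlim_compose[OF tendsto_poly_div_exp filterlim_inverse_at_top_right])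
      then show ?thesis
        by (rule Lim_transform_eventually)
           (auto simp: exp_cutoff_def eventually_at_filter field_simps)
    qed
    ultimately have "((\<lambda>y. exp_cutoff p y / y) \<longlongrightarrow> 0) (at 0)"
      by (simp add: filterlim_split_at)
    then show ?thesis using 2
      by (simp add: has_field_derivative_iff exp_cutoff_def)
  qed
qed

lemma smooth_exp_cutoff: "smooth (exp_cutoff p)"
proof -
  have "diff_upto n (exp_cutoff p)" for n
    using differentiable_on_UNIV_I[OF exp_cutoff_DERIV]
    by (induction n arbitrary: p) simp_all
  then show ?thesis by (simp add: smooth_iff)
qed

text \<open>The scaling by \<open>Suc n\<close> drives both exponents to 0 at each interior point,
  so the bumps approximate the indicator of the open interval from below; this makes interval
  integrals accessible to test functions. The arguments have the affine shape
  \<open>a + b * x\<close> to which \<open>smooth_affine_deriv\<close> applies.\<close>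

definition bump :: "real \<Rightarrow> real \<Rightarrow> nat \<Rightarrow> real \<Rightarrow> real" where
  "bump a b n x = 
    exp_cutoff 1 (- (real (Suc n) * a) + real (Suc n) * x) *
    exp_cutoff 1 (real (Suc n) * b + - real (Suc n) * x)"

lemma bump_eq:
  "bump a b n x = (if a < x \<and> x < b then exp (- 1 / (real (Suc n) * (x - a))) * exp (- 1 / (real (Suc n) * (b - x))) else 0)"
proof -
  have "- (real (Suc n) * a) + real (Suc n) * x = real (Suc n) * (x - a)"
       "real (Suc n) * b + - real (Suc n) * x = real (Suc n) * (b - x)" by (simp_all add: algebra_simps)
  then show ?thesis unfolding bump_def exp_cutoff_def
    by (simp add: zero_less_mult_iff del: of_nat_Suc)
qed

lemma test_function_bump: "test_function (bump a b n)"
proof -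
  have "smooth (bump a b n)"
    unfolding bump_def by (intro smooth_mult smooth_affine_deriv smooth_exp_cutoff)
  moreover have "compact (closure {x. bump a b n x \<noteq> 0})"
    by (simp, rule bounded_subset[of "{a..b}"]) (auto simp: bump_eq split: if_splits)
  ultimately show ?thesis by (simp add: test_function_def smooth_def)
qed

lemma bump_bound: "\<bar>bump a b n x\<bar> \<le> indicator {a..b} x"
proof -
  have "exp (- 1 / (real (Suc n) * (x - a))) * exp (- 1 / (real (Suc n) * (b - x))) \<le> 1 * 1" if "a < x" "x < b"
    using that by (intro mult_mono) (auto simp: zero_le_mult_iff)
  then show ?thesis by (auto simp: bump_eq indicator_def simp del: of_nat_Suc)
qed

lemma bump_tendsto: "(\<lambda>n. bump a b n x) \<longlonglongrightarrow> indicator {a<..<b} x"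
proof (cases "a < x \<and> x < b")
  case True
  have "(\<lambda>n. exp (- (1 / (x - a)) * inverse (real (Suc n))) * exp (- (1 / (b - x)) * inverse (real (Suc n))))
      \<longlonglongrightarrow> exp (- (1 / (x - a)) * 0) * exp (- (1 / (b - x)) * 0)"
    by (intro tendsto_intros LIMSEQ_inverse_real_of_nat)
  moreover have "bump a b n x = exp (- (1 / (x - a)) * inverse (real (Suc n))) * exp (- (1 / (b - x)) * inverse (real (Suc n)))" for n
    using True by (simp add: bump_eq divide_inverse mult.commute del: of_nat_Suc)
  ultimately show ?thesis using True by (simp del: of_nat_Suc)
next
  case False
  then show ?thesis by (auto simp: bump_eq indicator_def)
qed

lemma smooth_continuous: "smooth f \<Longrightarrow> continuous_on UNIV f"
  by (meson DERIV_continuous_on has_field_derivative_at_within smooth_DERIV)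

lemma smooth_measurable: "smooth f \<Longrightarrow> f \<in> borel_measurable borel"
  by (intro borel_measurable_continuous_onI smooth_continuous)

section \<open>Test functions, and the fundamental lemma of the calculus of variations\<close>

lemma test_function_iff: "test_function f \<longleftrightarrow> smooth f \<and> bounded {x. f x \<noteq> 0}"
  by (simp add: test_function_def smooth_def)

lemma test_function_measurable: "test_function f \<Longrightarrow> f \<in> borel_measurable borel"
  by (simp add: test_function_iff smooth_measurable)

lemma test_function_deriv:
  assumes "test_function f"
  shows "test_function (deriv f)"
proof -
  have "deriv f x = 0" if "x \<notin> closure {x. f x \<noteq> 0}" for x
  proof -
    have "((\<lambda>_. 0) has_real_derivative 0) (at x)" by simp
    then have "(f has_real_derivative 0) (at x)"
      by (rule has_field_derivative_transform_within_open[where S = "- closure {x. f x \<noteq> 0}"])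
         (use that closure_subset[of "{x. f x \<noteq> 0}"] in auto)
    then show ?thesis by (rule DERIV_imp_deriv)
  qed
  then have "{x. deriv f x \<noteq> 0} \<subseteq> closure {x. f x \<noteq> 0}" by auto
  with assms show ?thesis
    unfolding test_function_iff using bounded_closure bounded_subset smooth_deriv by blast
qed

lemma test_function_reflect:
  assumes "test_function f"
  shows "test_function (\<lambda>s. f (x - s))"
proof -
  have "smooth (\<lambda>s. f (x - s))"
    using smooth_affine_deriv(2)[of f x "-1"] assms by (simp add: test_function_iff)
  moreover have "{s. f (x - s) \<noteq> 0} \<subseteq> (+) x ` uminus ` {s. f s \<noteq> 0}"
    by (force simp: image_iff)
  moreover have "bounded ((+) x ` uminus ` {s. f s \<noteq> 0})"
    using assms by (simp add: test_function_iff bounded_translation bounded_uminus)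
  ultimately show ?thesis
    using bounded_subset by (auto simp: test_function_iff)
qed

lemma test_function_bound:
  assumes "test_function f"
  obtains r C where "r > 0" "C > 0" "\<And>x. \<bar>f x\<bar> \<le> C * indicator {-r..r} x"
proof -
  obtain r where r: "r > 0" "\<And>x. f x \<noteq> 0 \<Longrightarrow> \<bar>x\<bar> \<le> r"
    using assms unfolding test_function_iff bounded_pos by (auto simp: real_norm_def)
  have "compact (f ` {-r..r})"
    using assms smooth_continuous by (intro compact_continuous_image)
      (auto simp: test_function_iff intro: continuous_on_subset)
  then obtain C where C: "C > 0" "\<And>x. x \<in> {-r..r} \<Longrightarrow> \<bar>f x\<bar> \<le> C"
    using compact_imp_bounded[of "f ` {-r..r}"] unfolding bounded_pos by auto
  have "\<bar>f x\<bar> \<le> C * indicator {-r..r} x" for x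
    using r(2)[of x] C by (cases "f x = 0") (auto simp: indicator_def abs_le_iff)
  with r C show ?thesis using that by blast
qed

text \<open>Bumps and dominated convergence show that \<open>h\<close> has zero integral over every
  interval; Lebesgue differentiation then recovers \<open>h\<close> from these integrals outside a
  null set.\<close>

lemma AE_zero_if_test_integrals_zero:
  fixes h :: "real \<Rightarrow> complex"
  assumes int: "\<And>a b. set_integrable lborel {a..b} h"
    and zero: "\<And>\<phi>. test_function \<phi> \<Longrightarrow> (\<integral>x. h x * of_real (\<phi> x) \<partial>lborel) = 0"
  shows "AE x in lborel. h x = 0"
proof -
  have op: "(\<integral>x. indicator {a<..<b} x *\<^sub>R h x \<partial>lborel) = 0" for a b
  proof -
    have m [measurable]: "(\<lambda>x. indicator {a..b} x *\<^sub>R h x) \<in> borel_measurable lborel"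
      using int[of a b] unfolding set_integrable_def by (rule borel_measurable_integrable)
    have [measurable]: "(\<lambda>x. bump a b n x *\<^sub>R h x) \<in> borel_measurable lborel" for n
    proof -
      have [measurable]: "bump a b n \<in> borel_measurable borel"
        by (intro test_function_measurable test_function_bump)
      \<comment> \<open>Interval integrability provides measurability of the localised
        \<open>h\<close>; since the bump vanishes off \<open>{a..b}\<close>, inserting the indicator
        changes nothing.\<close>
      have "(\<lambda>x. bump a b n x *\<^sub>R (indicator {a..b} x *\<^sub>R h x)) \<in> borel_measurable lborel"
        by measurable
      also have "(\<lambda>x. bump a b n x *\<^sub>R (indicator {a..b} x *\<^sub>R h x)) = (\<lambda>x. bump a b n x *\<^sub>R h x)"
        by (auto simp: bump_eq indicator_def)
      finally show ?thesis .
    qed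
    have "(\<lambda>x. indicator {a<..<b} x *\<^sub>R (indicator {a..b} x *\<^sub>R h x)) \<in> borel_measurable lborel"
      by measurable
    also have "(\<lambda>x. indicator {a<..<b} x *\<^sub>R (indicator {a..b} x *\<^sub>R h x)) = (\<lambda>x. indicator {a<..<b} x *\<^sub>R h x)"
      by (auto simp: indicator_def)
    finally have [measurable]: "(\<lambda>x. indicator {a<..<b} x *\<^sub>R h x) \<in> borel_measurable lborel" .
    have "(\<lambda>n. \<integral>x. bump a b n x *\<^sub>R h x \<partial>lborel) \<longlonglongrightarrow> (\<integral>x. indicator {a<..<b} x *\<^sub>R h x \<partial>lborel)"
    proof (rule integral_dominated_convergence[where w = "\<lambda>x. norm (indicator {a..b} x *\<^sub>R h x)"])
      show "integrable lborel (\<lambda>x. norm (indicator {a..b} x *\<^sub>R h x))"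
        using int[of a b] unfolding set_integrable_def by (rule integrable_norm)
      show "AE x in lborel. (\<lambda>n. bump a b n x *\<^sub>R h x) \<longlonglongrightarrow> indicator {a<..<b} x *\<^sub>R h x"
        by (intro AE_I2 tendsto_intros bump_tendsto)
      show "AE x in lborel. norm (bump a b n x *\<^sub>R h x) \<le> norm (indicator {a..b} x *\<^sub>R h x)" for n
        using bump_bound[of a b n] by (intro AE_I2) (auto simp: intro!: mult_right_mono)
    qed measurable
    moreover have "(\<integral>x. bump a b n x *\<^sub>R h x \<partial>lborel) = 0" for n
      using zero[OF test_function_bump[of a b n]] by (simp add: scaleR_conv_of_real mult.commute)
    ultimately show ?thesis by (simp add: LIMSEQ_const_iff)
  qed
  have cl: "integral {a..b} h = 0" for a b
  proof -
    have "integral {a..b} h = integral {a<..<b} h" by (rule integral_open_interval_real)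
    also have "\<dots> = (LINT x:{a<..<b}|lborel. h x)"
      by (intro set_borel_integral_eq_integral(2)[symmetric] set_integrable_subset[OF int[of a b]]) auto
    also have "\<dots> = 0" using op by (simp add: set_lebesgue_integral_def)
    finally show ?thesis .
  qed
  have "h integrable_on cbox a b" for a b
    using set_borel_integral_eq_integral(1)[OF int] by (simp add: cbox_interval)
  \<comment> \<open>Lebesgue differentiation: off \<open>N\<close>, the averages over
    \<open>[x, x + k]\<close> converge to \<open>h x\<close>. All these averages are 0.\<close>
  from integrable_ccontinuous_explicit[OF this] obtain N where N: "negligible N"
    "\<And>x e. \<lbrakk>x \<notin> N; 0 < e\<rbrakk> \<Longrightarrow> \<exists>d>0. \<forall>k. 0 < k \<and> k < d \<longrightarrow>
       norm (integral (cbox x (x + k *\<^sub>R One)) h /\<^sub>R k ^ DIM(real) - h x) < e"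
    by metis
  have "h x = 0" if "x \<notin> N" for x
  proof (rule ccontr)
    assume "h x \<noteq> 0"
    with N(2)[OF that, of "norm (h x)"] obtain d where
      d: "d > 0" "\<And>k. 0 < k \<Longrightarrow> k < d \<Longrightarrow> norm (integral (cbox x (x + k *\<^sub>R One)) h /\<^sub>R k ^ DIM(real) - h x) < norm (h x)"
      by (metis zero_less_norm_iff)
    from d(2)[of "d/2"] d(1) show False by (simp add: cbox_interval cl)
  qed
  moreover have "AE x in lebesgue. x \<notin> N"
    using N(1) by (simp add: negligible_iff_null_sets AE_not_in)
  ultimately have "AE x in lebesgue. h x = 0" by (auto elim: AE_mp)
  then show ?thesis by (simp add: AE_completion_iff)
qed

text \<open>Difference quotients can be tested along sequences, which is the form that dominated
  convergence handles.\<close>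

lemma has_vector_derivative_slope:
  assumes "((\<lambda>y. (f y - f x) /\<^sub>R (y - x)) \<longlongrightarrow> D) (at x)"
  shows "(f has_vector_derivative D) (at x)"
proof -
  have "((\<lambda>y. norm ((f y - f x) /\<^sub>R (y - x) - D)) \<longlongrightarrow> 0) (at x)"
    using tendsto_norm[OF tendsto_diff[OF assms tendsto_const[of D]]] by simp
  then have "((\<lambda>y. norm ((f y - f x - (y - x) *\<^sub>R D) /\<^sub>R norm (y - x))) \<longlongrightarrow> 0) (at x)"
  proof (rule Lim_transform_eventually)
    have "norm ((f y - f x) /\<^sub>R (y - x) - D) = norm ((f y - f x - (y - x) *\<^sub>R D) /\<^sub>R norm (y - x))"
      if "y \<noteq> x" for y
    proof -
      have "(f y - f x) /\<^sub>R (y - x) - D = (f y - f x - (y - x) *\<^sub>R D) /\<^sub>R (y - x)"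
        using that by (simp add: scaleR_diff_right)
      then show ?thesis by simp
    qed
    then show "\<forall>\<^sub>F y in at x. norm ((f y - f x) /\<^sub>R (y - x) - D) =
        norm ((f y - f x - (y - x) *\<^sub>R D) /\<^sub>R norm (y - x))"
      by (auto simp: eventually_at_filter)
  qed
  then have "((\<lambda>y. (f y - f x - (y - x) *\<^sub>R D) /\<^sub>R norm (y - x)) \<longlongrightarrow> 0) (at x)"
    by (simp only: tendsto_norm_zero_iff)
  then show ?thesis
    unfolding has_vector_derivative_def has_derivative_within
    by (simp add: bounded_linear_scaleR_left diff_diff_eq divide_inverse_commute)
qed

subsection \<open>Mollification\<close>

text \<open>Convolution of \<open>u\<close> with an arbitrary test function rather than with an
  approximate identity: its value at 0 is the pairing of \<open>u\<close> with the reflected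
  \<open>\<rho>\<close>, so letting \<open>\<rho>\<close> vary is enough to identify
  \<open>u\<close> almost everywhere.\<close>

definition mollify :: "(real \<Rightarrow> complex) \<Rightarrow> (real \<Rightarrow> real) \<Rightarrow> real \<Rightarrow> complex" where
  "mollify u \<rho> x = (\<integral>s. \<rho> (x - s) *\<^sub>R u s \<partial>lborel)"

lemma mollify_integrable:
  fixes u :: "real \<Rightarrow> complex"
  assumes [measurable]: "u \<in> borel_measurable borel"
    and int: "\<And>a b. set_integrable lborel {a..b} u" and \<rho>: "test_function \<rho>"
  shows "integrable lborel (\<lambda>s. \<rho> (x - s) *\<^sub>R u s)"
proof -
  obtain r C where b: "\<And>x. \<bar>\<rho> x\<bar> \<le> C * indicator {-r..r} x" "C > 0"
    using test_function_bound[OF \<rho>] by metis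
  note [measurable] = test_function_measurable[OF \<rho>]
  have *: "integrable lborel (\<lambda>s. C *\<^sub>R (indicator {x-r..x+r} s *\<^sub>R u s))"
    using int unfolding set_integrable_def by (intro integrable_scaleR_right)
  show ?thesis
  proof (rule Bochner_Integration.integrable_bound[OF *])
    show "AE s in lborel. norm (\<rho> (x - s) *\<^sub>R u s) \<le> norm (C *\<^sub>R (indicator {x-r..x+r} s *\<^sub>R u s))"
    proof (intro AE_I2)
      fix s
      have "indicator {-r..r} (x - s) = (indicator {x-r..x+r} s :: real)" by (auto simp: indicator_def)
      with b(1)[of "x - s"] b(2) show "norm (\<rho> (x - s) *\<^sub>R u s) \<le> norm (C *\<^sub>R (indicator {x-r..x+r} s *\<^sub>R u s))"
        by (auto simp: indicator_def intro!: mult_right_mono)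
    qed
  qed measurable
qed

lemma mollify_has_vector_derivative:
  assumes [measurable]: "u \<in> borel_measurable borel"
    and int: "\<And>a b. set_integrable lborel {a..b} u" and \<rho>: "test_function \<rho>"
  shows "(mollify u \<rho> has_vector_derivative mollify u (deriv \<rho>) x) (at x)"
proof (rule has_vector_derivative_slope, unfold tendsto_at_iff_sequentially, intro allI impI)
  fix X :: "nat \<Rightarrow> real"
  assume X: "\<forall>i. X i \<in> UNIV - {x}" "X \<longlonglongrightarrow> x"
  have \<rho>': "test_function (deriv \<rho>)" by (rule test_function_deriv[OF \<rho>])
  note [measurable] = test_function_measurable[OF \<rho>] test_function_measurable[OF \<rho>']
  have D: "(\<rho> has_real_derivative deriv \<rho> y) (at y)" for y
    using \<rho> smooth_DERIV by (simp add: test_function_iff)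
  obtain r C where b: "\<And>x. \<bar>\<rho> x\<bar> \<le> C * indicator {-r..r} x" "r > 0"
    using test_function_bound[OF \<rho>] by metis
  obtain r' C' where b': "\<And>x. \<bar>deriv \<rho> x\<bar> \<le> C' * indicator {-r'..r'} x" "C' > 0"
    using test_function_bound[OF \<rho>'] by metis
  obtain K where K: "\<And>i. \<bar>X i\<bar> \<le> K"
    using convergent_imp_Bseq[of X] X(2) unfolding convergent_def Bseq_def by auto
  \<comment> \<open>The window \<open>{-L..L}\<close> contains the supports of
    \<open>\<rho> (X i - s)\<close> and of \<open>\<rho> (x - s)\<close> in \<open>s\<close>, for
    all \<open>i\<close> at once, which makes the dominating function independent of
    \<open>i\<close>.\<close>
  define L where "L = K + \<bar>x\<bar> + r"
  let ?q = "\<lambda>i s. ((\<rho> (X i - s) - \<rho> (x - s)) / (X i - x)) *\<^sub>R u s"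
  have "(\<lambda>i. \<integral>s. ?q i s \<partial>lborel) \<longlonglongrightarrow> mollify u (deriv \<rho>) x"
    unfolding mollify_def
  proof (rule integral_dominated_convergence[where w = "\<lambda>s. norm (C' *\<^sub>R (indicator {-L..L} s *\<^sub>R u s))"])
    show "integrable lborel (\<lambda>s. norm (C' *\<^sub>R (indicator {-L..L} s *\<^sub>R u s)))"
      using int unfolding set_integrable_def by (intro integrable_norm integrable_scaleR_right)
    show "AE s in lborel. (\<lambda>i. ?q i s) \<longlonglongrightarrow> deriv \<rho> (x - s) *\<^sub>R u s"
    proof (intro AE_I2 tendsto_intros)
      fix s
      have "((\<lambda>y. (\<rho> y - \<rho> (x - s)) / (y - (x - s))) \<longlongrightarrow> deriv \<rho> (x - s)) (at (x - s))"
        using D[of "x - s"] by (simp add: has_field_derivative_iff)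
      moreover have "filterlim (\<lambda>i. X i - s) (at (x - s)) sequentially"
        using X by (auto simp: filterlim_at intro!: tendsto_intros)
      ultimately have "(\<lambda>i. (\<rho> (X i - s) - \<rho> (x - s)) / (X i - s - (x - s))) \<longlonglongrightarrow> deriv \<rho> (x - s)"
        by (rule filterlim_compose)
      then show "(\<lambda>i. (\<rho> (X i - s) - \<rho> (x - s)) / (X i - x)) \<longlonglongrightarrow> deriv \<rho> (x - s)"
        by simp
    qed
    show "AE s in lborel. norm (?q i s) \<le> norm (C' *\<^sub>R (indicator {-L..L} s *\<^sub>R u s))" for i
    proof (intro AE_I2)
      fix s
      have ne: "X i \<noteq> x" using X by auto
      show "norm (?q i s) \<le> norm (C' *\<^sub>R (indicator {-L..L} s *\<^sub>R u s))"
      proof (cases "s \<in> {-L..L}")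
        case False
        then have "\<rho> (X i - s) = 0" "\<rho> (x - s) = 0"
          using K[of i] b(1)[of "X i - s"] b(1)[of "x - s"] b(2)
          by (auto simp: L_def indicator_def abs_le_iff of_bool_def split: if_splits)
        then show ?thesis by simp
      next
        case True
        \<comment> \<open>The mean value inequality bounds all difference quotients by the supremum
          of the derivative.\<close>
        have "norm (\<rho> (X i - s) - \<rho> (x - s)) \<le> C' * norm (X i - s - (x - s))"
        proof (rule field_differentiable_bound[of UNIV])
          show "(\<rho> has_real_derivative deriv \<rho> z) (at z within UNIV)" for z
            by (rule D)
          show "norm (deriv \<rho> z) \<le> C'" for z
            using b'(1)[of z] b'(2) by (auto simp: indicator_def of_bool_def split: if_splits)
        qed auto
        then have "\<bar>(\<rho> (X i - s) - \<rho> (x - s)) / (X i - x)\<bar> \<le> C'"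
          using ne by (simp add: divide_simps)
        then have "norm (?q i s) \<le> C' * cmod (u s)"
          unfolding norm_scaleR by (intro mult_right_mono) auto
        then show ?thesis using True b'(2) by simp
      qed
    qed
  qed measurable
  moreover have "(\<integral>s. ?q i s \<partial>lborel) = (mollify u \<rho> (X i) - mollify u \<rho> x) /\<^sub>R (X i - x)" for i
  proof -
    have "?q i s = (\<rho> (X i - s) *\<^sub>R u s - \<rho> (x - s) *\<^sub>R u s) /\<^sub>R (X i - x)" for s
      by (simp add: divide_inverse mult.commute scaleR_left_diff_distrib scaleR_right_diff_distrib
          right_diff_distrib)
    then show ?thesis
      unfolding mollify_def
      by (simp add: Bochner_Integration.integral_diff mollify_integrable[OF _ int \<rho>])
  qed
  ultimately show "((\<lambda>y. (mollify u \<rho> y - mollify u \<rho> x) /\<^sub>R (y - x)) \<circ> X) \<longlonglongrightarrow> mollify u (deriv \<rho>) x"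
    by (simp add: o_def)
qed

text \<open>The value at \<open>x\<close> sees \<open>u\<close> only through its square mass on a
  window about \<open>x\<close>, which tends to 0 as the window moves to infinity. The inequality
  \<open>c \<le> \<eta> + c^2 / \<eta>\<close> stands in for Cauchy-Schwarz. As derivatives of a
  mollification are mollifications with derivatives of \<open>\<rho>\<close>, the same statement
  gives the decay of the first derivative. The sign \<open>\<sigma>\<close> selects the end of the
  line.\<close>

lemma mollify_tendsto_0:
  fixes \<sigma> :: real
  assumes [measurable]: "u \<in> borel_measurable borel"
    and sq: "integrable lborel (\<lambda>x. (cmod (u x))\<^sup>2)" and \<rho>: "test_function \<rho>" and \<sigma>: "\<bar>\<sigma>\<bar> = 1"
  shows "((\<lambda>x. mollify u \<rho> (\<sigma> * x)) \<longlongrightarrow> 0) at_top"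
proof -
  obtain r C where b: "\<And>x. \<bar>\<rho> x\<bar> \<le> C * indicator {-r..r} x" "r > 0" "C > 0"
    using test_function_bound[OF \<rho>] by metis
  note [measurable] = test_function_measurable[OF \<rho>]
  define I where "I x = (\<integral>s. indicator {x-r..x+r} s * (cmod (u s))\<^sup>2 \<partial>lborel)" for x
  have I0: "((\<lambda>x. I (\<sigma> * x)) \<longlongrightarrow> 0) at_top"
  proof -
    have "((\<lambda>x. I (\<sigma> * x)) \<longlongrightarrow> (\<integral>s. 0 \<partial>(lborel :: real measure))) at_top"
      unfolding I_def
    proof (rule integral_dominated_convergence_at_top[OF _ _ sq])
      show "AE s in lborel. ((\<lambda>x. indicator {\<sigma> * x - r..\<sigma> * x + r} s * (cmod (u s))\<^sup>2) \<longlongrightarrow> 0) at_top"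
      proof (intro AE_I2 tendsto_eventually)
        fix s
        have "indicator {\<sigma> * x - r..\<sigma> * x + r} s = (0::real)" if "x > \<bar>s\<bar> + r" for x
        proof -
          have "\<bar>\<sigma> * x\<bar> = \<bar>x\<bar>" using \<sigma> by (simp add: abs_mult)
          then show ?thesis using that b(2) by (auto simp: indicator_def)
        qed
        then show "\<forall>\<^sub>F x in at_top. indicator {\<sigma> * x - r..\<sigma> * x + r} s * (cmod (u s))\<^sup>2 = 0"
          by (intro eventually_mono[OF eventually_gt_at_top[of "\<bar>s\<bar> + r"]]) auto
      qed
      show "\<forall>\<^sub>F x in at_top. AE s in lborel. norm (indicator {\<sigma> * x - r..\<sigma> * x + r} s * (cmod (u s))\<^sup>2) \<le> (cmod (u s))\<^sup>2"
        by (auto simp: indicator_def)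
    qed measurable
    then show ?thesis by simp
  qed
  have bd: "cmod (mollify u \<rho> x) \<le> C * (2 * r * \<eta> + I x / \<eta>)" if \<eta>: "\<eta> > 0" for x \<eta>
  proof -
    have i1: "integrable lborel (\<lambda>s. indicator {x-r..x+r} s * (cmod (u s))\<^sup>2)"
      using sq by (rule Bochner_Integration.integrable_bound) (auto simp: indicator_def)
    have i2: "integrable lborel (indicator {x-r..x+r} :: real \<Rightarrow> real)"
      by (rule integrable_real_indicator) (auto simp: emeasure_lborel_Icc_eq)
    have "cmod (mollify u \<rho> x) \<le> (\<integral>s. norm (\<rho> (x - s) *\<^sub>R u s) \<partial>lborel)"
      unfolding mollify_def by (rule integral_norm_bound)
    also have "\<dots> \<le> (\<integral>s. C * (\<eta> * indicator {x-r..x+r} s + (indicator {x-r..x+r} s * (cmod (u s))\<^sup>2) / \<eta>) \<partial>lborel)"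
    proof (rule integral_mono')
      show "integrable lborel (\<lambda>s. C * (\<eta> * indicator {x-r..x+r} s + (indicator {x-r..x+r} s * (cmod (u s))\<^sup>2) / \<eta>))"
        using i1 i2 by auto
      fix s
      have "cmod (u s) \<le> \<eta> + (cmod (u s))\<^sup>2 / \<eta>"
      proof (cases "cmod (u s) \<le> \<eta>")
        case False
        then have "cmod (u s) * \<eta> \<le> (cmod (u s))\<^sup>2"
          by (simp add: power2_eq_square mult_left_mono)
        then have "cmod (u s) \<le> (cmod (u s))\<^sup>2 / \<eta>" using \<eta> by (simp add: pos_le_divide_eq)
        then show ?thesis using \<eta> by linarith
      qed (use \<eta> in \<open>simp add: add_increasing2\<close>)
      moreover have "indicator {-r..r} (x - s) = (indicator {x-r..x+r} s :: real)" by (auto simp: indicator_def)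
      then have "\<bar>\<rho> (x - s)\<bar> \<le> C * indicator {x-r..x+r} s" using b(1)[of "x - s"] by simp
      ultimately have "\<bar>\<rho> (x - s)\<bar> * cmod (u s) \<le> (C * indicator {x-r..x+r} s) * (\<eta> + (cmod (u s))\<^sup>2 / \<eta>)"
        using b by (intro mult_mono) auto
      then show "norm (\<rho> (x - s) *\<^sub>R u s) \<le> C * (\<eta> * indicator {x-r..x+r} s + (indicator {x-r..x+r} s * (cmod (u s))\<^sup>2) / \<eta>)"
        by (simp add: algebra_simps)
    qed (use b \<eta> in \<open>auto intro!: mult_nonneg_nonneg add_nonneg_nonneg\<close>)
    also have "\<dots> = C * (\<eta> * (\<integral>s. indicator {x-r..x+r} s \<partial>lborel) + I x / \<eta>)"
      unfolding I_def using i1 i2 by (simp add: integral_add)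
    also have "\<dots> = C * (2 * r * \<eta> + I x / \<eta>)" using b(2) by simp
    finally show ?thesis .
  qed
  show ?thesis
  proof (rule tendstoI)
    fix e :: real assume e: "e > 0"
    \<comment> \<open>This choice makes \<open>C * (2 * r * \<eta>)\<close> equal to
      \<open>e / 2\<close>; the mass term accounts for the other half.\<close>
    define \<eta> where "\<eta> = e / (4 * r * C)"
    have \<eta>: "\<eta> > 0" using e b by (simp add: \<eta>_def)
    have "\<forall>\<^sub>F x in at_top. dist (I (\<sigma> * x)) 0 < \<eta> * e / (2 * C)"
      using e b \<eta> by (intro tendstoD[OF I0]) simp
    then show "\<forall>\<^sub>F x in at_top. dist (mollify u \<rho> (\<sigma> * x)) 0 < e"
    proof (rule eventually_mono)
      fix x assume "dist (I (\<sigma> * x)) 0 < \<eta> * e / (2 * C)"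
      then have "I (\<sigma> * x) < \<eta> * e / (2 * C)" by (simp add: dist_real_def)
      then have "I (\<sigma> * x) / \<eta> < e / (2 * C)" using \<eta> by (simp add: field_simps)
      then have "C * (2 * r * \<eta> + I (\<sigma> * x) / \<eta>) < C * (2 * r * \<eta> + e / (2 * C))" using b by simp
      also have "\<dots> = e" using b by (simp add: \<eta>_def field_simps)
      finally show "dist (mollify u \<rho> (\<sigma> * x)) 0 < e" using bd[OF \<eta>, of "\<sigma> * x"] by simp
    qed
  qed
qed

text \<open>Integrating the derivatives of \<open>e\<^sup>i\<^sup>k\<^sup>t (u' - i k u)\<close> over the positive and of
  \<open>e\<^sup>-\<^sup>i\<^sup>k\<^sup>t (u' + i k u)\<close> over the negative half-line; the exponentials stay bounded even for
  real \<open>k\<close>.\<close>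

lemma helmholtz_solution_at_0:
  fixes u u' v :: "real \<Rightarrow> complex"
  assumes k: "Im k \<ge> 0"
    and du: "\<And>x. (u has_vector_derivative u' x) (at x)"
    and du': "\<And>x. (u' has_vector_derivative (v x - k\<^sup>2 * u x)) (at x)"
    and cv: "continuous_on UNIV v" and iv: "integrable lborel v"
    and lim: "(u \<longlongrightarrow> 0) at_top" "(u \<longlongrightarrow> 0) at_bot" "(u' \<longlongrightarrow> 0) at_top" "(u' \<longlongrightarrow> 0) at_bot"
  shows "2 * \<i> * k * u 0 = (\<integral>t. exp (\<i> * k * of_real \<bar>t\<bar>) * v t \<partial>lborel)"
proof -
  note [measurable] = borel_measurable_continuous_onI[OF cv]
  define E where "E j t = exp (\<i> * j * of_real t) * (u' t - \<i> * j * u t)" for j t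
  define g where "g j t = exp (\<i> * j * of_real t) * v t" for j t
  \<comment> \<open>Both \<open>j = k\<close> and \<open>j = - k\<close> are used. The product rule
    cancels the terms in the first derivative, and the two multiples of \<open>u\<close> cancel
    because \<open>j\<close> and \<open>k\<close> have the same square.\<close>
  have dE: "(E j has_vector_derivative g j t) (at t)" if "j\<^sup>2 = k\<^sup>2" for j t
  proof -
    have "((\<lambda>t. exp (\<i> * j * of_real t)) has_vector_derivative \<i> * j * exp (\<i> * j * of_real t)) (at t)"
    proof -
      have "((\<lambda>w. exp (\<i> * j * w)) has_field_derivative \<i> * j * exp (\<i> * j * of_real t)) (at (of_real t))"
        by (auto intro!: derivative_eq_intros)
      from has_vector_derivative_real_field[OF this] show ?thesis .
    qed
    note d = has_vector_derivative_mult[OF this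
        has_vector_derivative_diff[OF du'[of t] has_vector_derivative_mult_right[OF du[of t], where a = "\<i> * j"]]]
    have "exp (\<i> * j * of_real t) * (v t - k\<^sup>2 * u t - \<i> * j * u' t) +
        \<i> * j * exp (\<i> * j * of_real t) * (u' t - \<i> * j * u t) =
        exp (\<i> * j * of_real t) * (v t - k\<^sup>2 * u t + j\<^sup>2 * u t)"
      by (simp add: algebra_simps power2_eq_square)
    with d that show ?thesis by (simp add: E_def[abs_def] g_def mult_ac)
  qed
  have cg: "isCont (g j) t" for j t
    unfolding g_def using cv by (auto intro!: continuous_intros simp: continuous_on_eq_continuous_at)
  have expb: "cmod (exp (\<i> * j * of_real t)) \<le> 1" if "Im j * t \<ge> 0" for j t
    using that by (simp add: norm_exp_eq_Re)
  have ig: "set_integrable lborel S (g j)" if "S \<in> sets borel" "\<And>t. t \<in> S \<Longrightarrow> Im j * t \<ge> 0" for S j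
    unfolding set_integrable_def
  proof (rule Bochner_Integration.integrable_bound[OF iv])
    have [measurable]: "g j \<in> borel_measurable borel"
      using cg by (intro borel_measurable_continuous_onI) (simp add: continuous_on_eq_continuous_at)
    show "(\<lambda>t. indicator S t *\<^sub>R g j t) \<in> borel_measurable lborel" using that(1) by measurable
    show "AE t in lborel. norm (indicator S t *\<^sub>R g j t) \<le> norm (v t)"
      using that(2) expb by (auto simp: g_def indicator_def norm_mult intro!: mult_left_le_one_le)
  qed
  have limE: "(E j \<longlongrightarrow> 0) F" if "(u \<longlongrightarrow> 0) F" "(u' \<longlongrightarrow> 0) F" "\<forall>\<^sub>F t in F. Im j * t \<ge> 0" for F j
  proof (rule Lim_null_comparison)
    have "((\<lambda>t. norm (u' t - \<i> * j * u t)) \<longlongrightarrow> norm (0 - \<i> * j * 0)) F"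
      by (intro tendsto_intros that)
    then show "((\<lambda>t. norm (u' t - \<i> * j * u t)) \<longlongrightarrow> 0) F" by simp
    show "\<forall>\<^sub>F t in F. norm (E j t) \<le> norm (u' t - \<i> * j * u t)"
      using that(3) by (rule eventually_mono) (auto simp: E_def norm_mult intro!: mult_left_le_one_le expb)
  qed
  have contE: "isCont (E j) 0" if "j\<^sup>2 = k\<^sup>2" for j
    using dE[OF that] has_vector_derivative_continuous by blast
  have "(LBINT t=ereal 0..\<infinity>. g k t) = 0 - E k 0"
  proof (rule interval_integral_FTC_integrable)
    show "((E k \<circ> real_of_ereal) \<longlongrightarrow> 0) (at_left \<infinity>)"
      unfolding ereal_tendsto_simps
      by (rule limE[OF lim(1,3)]) (intro eventually_mono[OF eventually_ge_at_top[of 0]], simp add: k)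
    show "((E k \<circ> real_of_ereal) \<longlongrightarrow> E k 0) (at_right (ereal 0))"
      unfolding ereal_tendsto_simps using contE[of k] by (simp add: isCont_def filterlim_at_split)
    show "set_integrable lborel (einterval (ereal 0) \<infinity>) (g k)"
      using k by (intro ig) (auto simp: einterval_iff)
  qed (auto intro: dE cg)
  then have 1: "(LINT t:{0<..}|lborel. g k t) = - E k 0"
    by (simp add: interval_lebesgue_integral_def zero_ereal_def)
  have "(LBINT t=-\<infinity>..ereal 0. g (-k) t) = E (-k) 0 - 0"
  proof (rule interval_integral_FTC_integrable)
    show "((E (-k) \<circ> real_of_ereal) \<longlongrightarrow> 0) (at_right (-\<infinity>))"
      unfolding ereal_tendsto_simps
      by (rule limE[OF lim(2,4)]) (intro eventually_mono[OF eventually_le_at_bot[of 0]], simp add: k mult_nonneg_nonpos)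
    show "((E (-k) \<circ> real_of_ereal) \<longlongrightarrow> E (-k) 0) (at_left (ereal 0))"
      unfolding ereal_tendsto_simps using contE[of "-k"] by (simp add: isCont_def filterlim_at_split)
    show "set_integrable lborel (einterval (-\<infinity>) (ereal 0)) (g (-k))"
      using k by (intro ig) (auto simp: einterval_iff mult_nonneg_nonpos)
  qed (auto intro: dE cg)
  then have 2: "(LINT t:{..<0}|lborel. g (-k) t) = E (-k) 0"
    by (simp add: interval_lebesgue_integral_def zero_ereal_def)
  \<comment> \<open>In \<open>E (-k) 0 - E k 0\<close> the values of \<open>u'\<close> cancel and
    those of \<open>u\<close> add up.\<close>
  have "2 * \<i> * k * u 0 = (LINT t:{0<..}|lborel. g k t) + (LINT t:{..<0}|lborel. g (-k) t)"
    unfolding 1 2 by (simp add: E_def)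
  also have "\<dots> = (\<integral>t. indicator {0<..} t *\<^sub>R g k t + indicator {..<0} t *\<^sub>R g (-k) t \<partial>lborel)"
    unfolding set_lebesgue_integral_def
    using ig[of "{0<..}" k] ig[of "{..<0}" "-k"] k unfolding set_integrable_def
    by (subst Bochner_Integration.integral_add) (auto simp: mult_nonneg_nonpos)
  also have "\<dots> = (\<integral>t. exp (\<i> * k * of_real \<bar>t\<bar>) * v t \<partial>lborel)"
  proof (rule integral_cong_AE)
    have "AE t in lborel. t \<noteq> (0::real)" by (rule AE_lborel_singleton)
    then show "AE t in lborel. indicator {0<..} t *\<^sub>R g k t + indicator {..<0} t *\<^sub>R g (-k) t =
        exp (\<i> * k * of_real \<bar>t\<bar>) * v t"
      by (rule AE_mp) (auto simp: g_def indicator_def abs_if)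
  qed (unfold g_def, measurable)
  finally show ?thesis .
qed

text \<open>Associativity of convolution, read off at the point 0: smoothing the source is traded
  for smoothing the solution. Fubini applies because the exponential is bounded by 1 in the closed
  upper half-plane, real \<open>k\<close> included, and both \<open>\<rho>\<close> and
  \<open>w\<close> are integrable.\<close>

lemma mollify_L1:
  assumes w: "integrable lborel w" and \<rho>: "test_function \<rho>"
  shows "integrable lborel (mollify w \<rho>)"
    and "Im k \<ge> 0 \<Longrightarrow> (\<integral>t. exp (\<i> * k * of_real \<bar>t\<bar>) * mollify w \<rho> t \<partial>lborel) =
      (\<integral>r. of_real (\<rho> (- r)) * (\<integral>s. exp (\<i> * k * of_real \<bar>r - s\<bar>) * w s \<partial>lborel) \<partial>lborel)"
proof -
  note [measurable] = test_function_measurable[OF \<rho>] borel_measurable_integrable[OF w]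
  obtain r C where b: "\<And>x. \<bar>\<rho> x\<bar> \<le> C * indicator {-r..r} x" "r > 0" "C > 0"
    using test_function_bound[OF \<rho>] by metis
  have i\<rho>: "integrable lborel (\<lambda>t. \<rho> t)"
  proof (rule Bochner_Integration.integrable_bound)
    show "integrable lborel (\<lambda>t. C * indicator {-r..r} t :: real)"
      by (intro integrable_mult_right integrable_real_indicator) (auto simp: emeasure_lborel_Icc_eq)
    show "AE x in lborel. norm (\<rho> x) \<le> norm (C * indicat_real {- r..r} x)"
      using b by (auto intro: order_trans[OF _ abs_ge_self])
  qed measurable
  have i\<rho>1: "integrable lborel (\<lambda>t. \<rho> (t - s))" for s
    using lborel_integrable_real_affine[OF i\<rho>, of 1 "-s"] by simp
  have i\<rho>2: "integrable lborel (\<lambda>t. \<rho> (- t))"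
    using lborel_integrable_real_affine[OF i\<rho>, of "-1" 0] by simp
  have int1: "integrable (lborel \<Otimes>\<^sub>M lborel) (\<lambda>(s, t). e t * (\<rho> (t - s) *\<^sub>R w s))"
    if [measurable]: "e \<in> borel_measurable borel" and e: "\<And>t. cmod (e t) \<le> 1" for e :: "real \<Rightarrow> complex"
  proof (rule lborel_pair.Fubini_integrable)
    have *: "integrable lborel (\<lambda>t. e t * (\<rho> (t - s) *\<^sub>R w s))" for s
    proof (rule Bochner_Integration.integrable_bound)
      show "integrable lborel (\<lambda>t. \<rho> (t - s) * cmod (w s))" by (intro integrable_mult_left i\<rho>1)
      show "AE t in lborel. cmod (e t * (\<rho> (t - s) *\<^sub>R w s)) \<le> norm (\<rho> (t - s) * cmod (w s))"
        using e by (intro AE_I2) (auto simp: norm_mult abs_mult intro!: mult_left_mono mult_left_le_one_le)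
    qed measurable
    then show "AE s in lborel. integrable lborel (\<lambda>t. case (s, t) of (s, t) \<Rightarrow> e t * (\<rho> (t - s) *\<^sub>R w s))"
      by simp
    show "integrable lborel (\<lambda>s. \<integral>t. norm (case (s, t) of (s, t) \<Rightarrow> e t * (\<rho> (t - s) *\<^sub>R w s)) \<partial>lborel)"
    proof (rule Bochner_Integration.integrable_bound)
      show "integrable lborel (\<lambda>s. (\<integral>t. \<bar>\<rho> t\<bar> \<partial>lborel) * cmod (w s))"
        using w by auto
      show "AE s in lborel. norm (\<integral>t. norm (case (s, t) of (s, t) \<Rightarrow> e t * (\<rho> (t - s) *\<^sub>R w s)) \<partial>lborel)
          \<le> norm ((\<integral>t. \<bar>\<rho> t\<bar> \<partial>lborel) * cmod (w s))"
      proof (rule AE_I2)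
        fix s
        have "(\<integral>t. norm (e t * (\<rho> (t - s) *\<^sub>R w s)) \<partial>lborel) \<le> (\<integral>t. \<bar>\<rho> (t - s)\<bar> * cmod (w s) \<partial>lborel)"
          using e by (intro integral_mono integrable_norm * integrable_mult_left integrable_abs i\<rho>1)
            (auto simp: norm_mult intro!: mult_left_mono mult_left_le_one_le)
        also have "\<dots> = (\<integral>t. \<bar>\<rho> t\<bar> \<partial>lborel) * cmod (w s)"
          using lborel_integral_real_affine[of 1 "\<lambda>t. \<bar>\<rho> t\<bar>" "-s"] by simp
        finally show "norm (\<integral>t. norm (case (s, t) of (s, t) \<Rightarrow> e t * (\<rho> (t - s) *\<^sub>R w s)) \<partial>lborel)
          \<le> norm ((\<integral>t. \<bar>\<rho> t\<bar> \<partial>lborel) * cmod (w s))"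
          by (simp add: abs_mult)
      qed
    qed measurable
  qed measurable
  show "integrable lborel (mollify w \<rho>)"
    using lborel_pair.integrable_snd[OF int1[of "\<lambda>_. 1"]] by (simp add: mollify_def[abs_def])
  assume k: "Im k \<ge> 0"
  define e where "e t = exp (\<i> * k * of_real \<bar>t\<bar>)" for t
  have [measurable]: "e \<in> borel_measurable borel" unfolding e_def by measurable
  have e: "cmod (e t) \<le> 1" for t using k by (simp add: e_def norm_exp_eq_Re)
  have "(\<integral>t. e t * mollify w \<rho> t \<partial>lborel) = (\<integral>t. (\<integral>s. e t * (\<rho> (t - s) *\<^sub>R w s) \<partial>lborel) \<partial>lborel)"
    by (simp add: mollify_def del: mult_scaleR_right)
  also have "\<dots> = (\<integral>s. (\<integral>t. e t * (\<rho> (t - s) *\<^sub>R w s) \<partial>lborel) \<partial>lborel)"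
    by (rule lborel_pair.Fubini_integral[OF int1]) (auto simp: e)
  also have "\<dots> = (\<integral>s. (\<integral>r. e (r - s) * (\<rho> (- r) *\<^sub>R w s) \<partial>lborel) \<partial>lborel)"
  proof (rule Bochner_Integration.integral_cong[OF refl])
    fix s
    \<comment> \<open>The substitution \<open>t = s - r\<close> moves \<open>\<rho>\<close> away
      from \<open>s\<close>; evenness of \<open>e\<close> turns \<open>e (s - r)\<close> into
      \<open>e (r - s)\<close>.\<close>
    show "(\<integral>t. e t * (\<rho> (t - s) *\<^sub>R w s) \<partial>lborel) = (\<integral>r. e (r - s) * (\<rho> (- r) *\<^sub>R w s) \<partial>lborel)"
      using lborel_integral_real_affine[of "-1" "\<lambda>t. e t * (\<rho> (t - s) *\<^sub>R w s)" s]
      by (simp add: e_def abs_minus_commute del: mult_scaleR_right)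
  qed
  also have "\<dots> = (\<integral>r. (\<integral>s. e (r - s) * (\<rho> (- r) *\<^sub>R w s) \<partial>lborel) \<partial>lborel)"
  proof (rule lborel_pair.Fubini_integral[symmetric], rule lborel_pair.Fubini_integrable)
    have *: "integrable lborel (\<lambda>r. e (r - s) * (\<rho> (- r) *\<^sub>R w s))" for s
    proof (rule Bochner_Integration.integrable_bound)
      show "integrable lborel (\<lambda>r. \<rho> (- r) * cmod (w s))" by (intro integrable_mult_left i\<rho>2)
      show "AE r in lborel. cmod (e (r - s) * (\<rho> (- r) *\<^sub>R w s)) \<le> norm (\<rho> (- r) * cmod (w s))"
        using e by (intro AE_I2) (auto simp: norm_mult abs_mult intro!: mult_left_mono mult_left_le_one_le)
    qed measurable
    then show "AE s in lborel. integrable lborel (\<lambda>r. case (s, r) of (s, r) \<Rightarrow> e (r - s) * (\<rho> (- r) *\<^sub>R w s))"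
      by simp
    show "integrable lborel (\<lambda>s. \<integral>r. norm (case (s, r) of (s, r) \<Rightarrow> e (r - s) * (\<rho> (- r) *\<^sub>R w s)) \<partial>lborel)"
    proof (rule Bochner_Integration.integrable_bound)
      show "integrable lborel (\<lambda>s. (\<integral>t. \<bar>\<rho> (- t)\<bar> \<partial>lborel) * cmod (w s))"
        using w by auto
      show "AE s in lborel. norm (\<integral>r. norm (case (s, r) of (s, r) \<Rightarrow> e (r - s) * (\<rho> (- r) *\<^sub>R w s)) \<partial>lborel)
          \<le> norm ((\<integral>t. \<bar>\<rho> (- t)\<bar> \<partial>lborel) * cmod (w s))"
      proof (rule AE_I2)
        fix s
        have "(\<integral>r. norm (e (r - s) * (\<rho> (- r) *\<^sub>R w s)) \<partial>lborel) \<le> (\<integral>r. \<bar>\<rho> (- r)\<bar> * cmod (w s) \<partial>lborel)"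
          using e by (intro integral_mono integrable_norm * integrable_mult_left integrable_abs i\<rho>2)
            (auto simp: norm_mult intro!: mult_left_mono mult_left_le_one_le)
        then show "norm (\<integral>r. norm (case (s, r) of (s, r) \<Rightarrow> e (r - s) * (\<rho> (- r) *\<^sub>R w s)) \<partial>lborel)
          \<le> norm ((\<integral>t. \<bar>\<rho> (- t)\<bar> \<partial>lborel) * cmod (w s))"
          by (simp add: abs_mult)
      qed
    qed measurable
  qed measurable
  also have "\<dots> = (\<integral>r. of_real (\<rho> (- r)) * (\<integral>s. e (r - s) * w s \<partial>lborel) \<partial>lborel)"
  proof (rule Bochner_Integration.integral_cong[OF refl])
    fix r
    have "(\<integral>s. e (r - s) * (\<rho> (- r) *\<^sub>R w s) \<partial>lborel) = (\<integral>s. \<rho> (- r) *\<^sub>R (e (r - s) * w s) \<partial>lborel)"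
      by simp
    also have "\<dots> = of_real (\<rho> (- r)) * (\<integral>s. e (r - s) * w s \<partial>lborel)"
      by (simp add: scaleR_conv_of_real del: mult_scaleR_right)
    finally show "(\<integral>s. e (r - s) * (\<rho> (- r) *\<^sub>R w s) \<partial>lborel) = of_real (\<rho> (- r)) * (\<integral>s. e (r - s) * w s \<partial>lborel)" .
  qed
  finally show "(\<integral>t. exp (\<i> * k * of_real \<bar>t\<bar>) * mollify w \<rho> t \<partial>lborel) =
      (\<integral>r. of_real (\<rho> (- r)) * (\<integral>s. exp (\<i> * k * of_real \<bar>r - s\<bar>) * w s \<partial>lborel) \<partial>lborel)"
    by (simp add: e_def)
qed

section \<open>From the weak equation to the integral equation\<close>

lemma square_integrable_imp_set_integrable:
  fixes f :: "real \<Rightarrow> complex"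
  assumes [measurable]: "f \<in> borel_measurable borel"
    and sq: "integrable lborel (\<lambda>x. (cmod (f x))\<^sup>2)"
  shows "set_integrable lborel {a..b} f"
  unfolding set_integrable_def
proof (rule Bochner_Integration.integrable_bound)
  show "integrable lborel (\<lambda>x. indicator {a..b} x + (cmod (f x))\<^sup>2 :: real)"
    by (intro Bochner_Integration.integrable_add sq integrable_real_indicator)
       (auto simp: emeasure_lborel_Icc_eq)
  have "c \<le> 1 + c\<^sup>2" for c :: real
    using zero_le_power2[of "c - 1/2"] by (simp add: power2_eq_square algebra_simps)
  then show "AE x in lborel. norm (indicator {a..b} x *\<^sub>R f x) \<le> norm (indicator {a..b} x + (cmod (f x))\<^sup>2)"
    by (intro AE_I2) (auto simp: indicator_def)
qed measurable

lemma norm_exp_abs_le: "Im k \<ge> 0 \<Longrightarrow> cmod (exp (\<i> * k * of_real \<bar>t\<bar>)) \<le> 1"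
  by (simp add: norm_exp_eq_Re)

lemma integrable_exp_abs:
  assumes w: "integrable lborel w" and k: "Im k \<ge> 0"
  shows "integrable lborel (\<lambda>s. exp (\<i> * k * of_real \<bar>r - s\<bar>) * w s)"
proof (rule Bochner_Integration.integrable_bound[OF w])
  note [measurable] = borel_measurable_integrable[OF w]
  show "(\<lambda>s. exp (\<i> * k * of_real \<bar>r - s\<bar>) * w s) \<in> borel_measurable lborel" by measurable
  show "AE s in lborel. cmod (exp (\<i> * k * of_real \<bar>r - s\<bar>) * w s) \<le> cmod (w s)"
    using norm_exp_abs_le[OF k] by (intro AE_I2) (auto simp: norm_mult intro!: mult_left_le_one_le)
qed

text \<open>Both sides are compared as distributions. Testing the weak equation against translates
  of a reflected test function says precisely that the mollified \<open>f\<close> solves the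
  classical equation with mollified source, so no regularity of \<open>f\<close> has to be
  established first. The representation at 0 is then transferred back to \<open>f\<close> by
  Fubini.\<close>

lemma weak_solution_integral_equation:
  fixes f w :: "real \<Rightarrow> complex"
  assumes f [measurable]: "f \<in> borel_measurable borel"
    and sq: "integrable lborel (\<lambda>x. (cmod (f x))\<^sup>2)"
    and w: "integrable lborel w" and k: "Im k \<ge> 0"
    and weak: "\<And>\<phi>. test_function \<phi> \<Longrightarrow>
       (\<integral>x. f x * of_real ((deriv ^^ 2) \<phi> x) \<partial>lborel) = (\<integral>x. (w x - k\<^sup>2 * f x) * of_real (\<phi> x) \<partial>lborel)"
  shows "AE x in lborel. 2 * \<i> * k * f x = (\<integral>s. exp (\<i> * k * of_real \<bar>x - s\<bar>) * w s \<partial>lborel)"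
proof -
  note wm [measurable] = borel_measurable_integrable[OF w]
  have wm': "w \<in> borel_measurable borel" by measurable
  note fi = square_integrable_imp_set_integrable[OF f sq]
  have wi: "set_integrable lborel {a..b} w" for a b
    unfolding set_integrable_def by (intro integrable_mult_indicator w) simp
  define P where "P r = (\<integral>s. exp (\<i> * k * of_real \<bar>r - s\<bar>) * w s \<partial>lborel)" for r
  have [measurable]: "P \<in> borel_measurable borel" unfolding P_def by measurable
  have Pb: "cmod (P r) \<le> (\<integral>s. cmod (w s) \<partial>lborel)" for r
    unfolding P_def
  proof (rule order_trans[OF integral_norm_bound integral_mono])
    show "integrable lborel (\<lambda>s. cmod (exp (\<i> * k * of_real \<bar>r - s\<bar>) * w s))"
      by (intro integrable_norm integrable_exp_abs w k)
  qed (use w norm_exp_abs_le[OF k] in \<open>auto simp: norm_mult intro!: mult_left_le_one_le\<close>)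
  have Pi: "set_integrable lborel {a..b} P" for a b
    unfolding set_integrable_def
    by (rule integrableI_bounded_set_indicator[where B = "\<integral>s. cmod (w s) \<partial>lborel"])
       (auto simp: emeasure_lborel_Icc_eq Pb)
  have "(\<integral>x. (2 * \<i> * k * f x - P x) * of_real (\<phi> x) \<partial>lborel) = 0" if \<phi>: "test_function \<phi>" for \<phi>
  proof -
    \<comment> \<open>The reflection is chosen so that the mollification with \<open>\<rho>\<close>
      at 0 is the pairing with \<open>\<phi>\<close>.\<close>
    define \<rho> where "\<rho> s = \<phi> (0 - s)" for s
    have \<rho>: "test_function \<rho>" unfolding \<rho>_def[abs_def] by (rule test_function_reflect[OF \<phi>])
    have \<rho>': "test_function (deriv \<rho>)" by (rule test_function_deriv[OF \<rho>])
    have lim: "((\<lambda>x. mollify f \<tau> x) \<longlongrightarrow> 0) at_top" "((\<lambda>x. mollify f \<tau> x) \<longlongrightarrow> 0) at_bot"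
      if "test_function \<tau>" for \<tau>
      using mollify_tendsto_0[OF f sq that, of 1] mollify_tendsto_0[OF f sq that, of "-1"]
      by (simp_all add: filterlim_at_bot_mirror)
    have "2 * \<i> * k * mollify f \<rho> 0 = (\<integral>t. exp (\<i> * k * of_real \<bar>t\<bar>) * mollify w \<rho> t \<partial>lborel)"
    proof (rule helmholtz_solution_at_0[OF k])
      show "(mollify f \<rho> has_vector_derivative mollify f (deriv \<rho>) x) (at x)" for x
        by (rule mollify_has_vector_derivative[OF f fi \<rho>])
      show "(mollify f (deriv \<rho>) has_vector_derivative (mollify w \<rho> x - k\<^sup>2 * mollify f \<rho> x)) (at x)" for x
      proof -
        \<comment> \<open>Each differentiation of the reflected function contributes a factor -1,
          and the two cancel.\<close>
        have aff: "(deriv ^^ 2) (\<lambda>s. \<rho> (x - s)) = (\<lambda>s. deriv (deriv \<rho>) (x - s))"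
          using smooth_affine_deriv(1)[of \<rho> 2 x "-1"] \<rho> by (simp add: test_function_iff numeral_2_eq_2)
        have "mollify f (deriv (deriv \<rho>)) x = (\<integral>s. f s * of_real ((deriv ^^ 2) (\<lambda>s. \<rho> (x - s)) s) \<partial>lborel)"
          unfolding aff by (simp add: mollify_def scaleR_conv_of_real mult.commute)
        also have "\<dots> = (\<integral>s. (w s - k\<^sup>2 * f s) * of_real (\<rho> (x - s)) \<partial>lborel)"
          by (rule weak) (rule test_function_reflect[OF \<rho>])
        also have "\<dots> = (\<integral>s. \<rho> (x - s) *\<^sub>R w s - k\<^sup>2 * (\<rho> (x - s) *\<^sub>R f s) \<partial>lborel)"
          by (intro Bochner_Integration.integral_cong refl) (simp add: scaleR_conv_of_real algebra_simps)
        also have "\<dots> = mollify w \<rho> x - k\<^sup>2 * mollify f \<rho> x"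
          unfolding mollify_def
          by (subst Bochner_Integration.integral_diff)
             (auto simp del: mult_scaleR_right intro!: integrable_mult_right mollify_integrable[OF f fi \<rho>] mollify_integrable[OF wm' wi \<rho>])
        finally show ?thesis using mollify_has_vector_derivative[OF f fi \<rho>', of x] by simp
      qed
      show "continuous_on UNIV (mollify w \<rho>)"
        using mollify_has_vector_derivative[OF wm' wi \<rho>]
        by (meson continuous_at_imp_continuous_on has_vector_derivative_continuous)
      show "integrable lborel (mollify w \<rho>)" by (rule mollify_L1(1)[OF w \<rho>])
    qed (rule lim \<rho> \<rho>')+
    also have "\<dots> = (\<integral>r. of_real (\<rho> (- r)) * P r \<partial>lborel)"
      unfolding P_def by (rule mollify_L1(2)[OF w \<rho> k])
    finally have eq: "2 * \<i> * k * (\<integral>s. \<phi> s *\<^sub>R f s \<partial>lborel) = (\<integral>s. \<phi> s *\<^sub>R P s \<partial>lborel)"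
      by (simp add: mollify_def \<rho>_def scaleR_conv_of_real)
    have "(\<integral>x. (2 * \<i> * k * f x - P x) * of_real (\<phi> x) \<partial>lborel) =
        (\<integral>x. 2 * \<i> * k * (\<phi> x *\<^sub>R f x) - \<phi> x *\<^sub>R P x \<partial>lborel)"
      by (intro Bochner_Integration.integral_cong refl) (simp add: scaleR_conv_of_real algebra_simps)
    also have "\<dots> = 2 * \<i> * k * (\<integral>s. \<phi> s *\<^sub>R f s \<partial>lborel) - (\<integral>s. \<phi> s *\<^sub>R P s \<partial>lborel)"
    proof -
      have "integrable lborel (\<lambda>s. \<phi> s *\<^sub>R f s)" "integrable lborel (\<lambda>s. \<phi> s *\<^sub>R P s)"
        using mollify_integrable[OF f fi \<rho>, of 0] mollify_integrable[OF _ Pi \<rho>, of 0]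
        by (simp_all add: \<rho>_def)
      then show ?thesis
        by (subst Bochner_Integration.integral_diff) (auto simp del: mult_scaleR_right)
    qed
    finally show ?thesis using eq by simp
  qed
  moreover have "set_integrable lborel {a..b} (\<lambda>x. 2 * \<i> * k * f x - P x)" for a b
    using set_integral_diff(1)[OF set_integrable_mult_right[OF fi, where a = "2 * \<i> * k"] Pi] by simp
  ultimately have "AE x in lborel. 2 * \<i> * k * f x - P x = 0"
    by (intro AE_zero_if_test_integrals_zero)
  then show ?thesis by (simp add: P_def)
qed

text \<open>An integrable bound on the values alone is enough: Cauchy's inequality converts it into
  an integrable bound on the complex derivatives, which dominates the difference quotients.\<close>

lemma holomorphic_on_lebesgue_integral:
  fixes F :: "complex \<Rightarrow> 'a \<Rightarrow> complex"
  assumes S: "open S"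
    and meas: "\<And>z. z \<in> S \<Longrightarrow> F z \<in> borel_measurable M"
    and hol: "\<And>t. (\<lambda>z. F z t) holomorphic_on S"
    and bound: "\<And>z t. z \<in> S \<Longrightarrow> cmod (F z t) \<le> g t"
    and g: "integrable M g"
  shows "(\<lambda>z. \<integral>t. F z t \<partial>M) holomorphic_on S"
  unfolding holomorphic_on_open[OF S]
proof (intro ballI)
  fix z assume z: "z \<in> S"
  have int: "integrable M (F z)" if "z \<in> S" for z
    by (rule Bochner_Integration.integrable_bound[OF g meas[OF that]])
       (use bound[OF that] in \<open>auto intro: order_trans[OF _ abs_ge_self]\<close>)
  \<comment> \<open>The factor 2 leaves room for a disc of radius \<open>r\<close> about each point
    of \<open>cball z r\<close>, as needed for Cauchy's inequality there.\<close>
  obtain r where r: "r > 0" "cball z (2 * r) \<subseteq> S"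
  proof -
    obtain e where "e > 0" "cball z e \<subseteq> S" using S z open_contains_cball by blast
    then show ?thesis using that[of "e / 2"] by simp
  qed
  define D where "D t = deriv (\<lambda>z. F z t) z" for t
  have der: "((\<lambda>z. F z t) has_field_derivative deriv (\<lambda>z. F z t) y) (at y)" if "y \<in> S" for y t
    using hol S that by (rule holomorphic_derivI)
  have db: "cmod (deriv (\<lambda>z. F z t) y) \<le> g t / r" if y: "y \<in> cball z r" for y t
  proof -
    have "dist z x \<le> 2 * r" if "dist y x \<le> r" for x
      using y that dist_triangle[of z x y] by simp
    then have sub: "cball y r \<subseteq> S" using r(2) by (auto simp: subset_iff)
    have "cmod ((deriv ^^ 1) (\<lambda>z. F z t) y) \<le> fact 1 * g t / r ^ 1"
    proof (rule Cauchy_inequality)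
      show "(\<lambda>z. F z t) holomorphic_on ball y r"
        using hol sub by (meson ball_subset_cball holomorphic_on_subset)
      show "continuous_on (cball y r) (\<lambda>z. F z t)"
        using hol sub holomorphic_on_imp_continuous_on holomorphic_on_subset by blast
      show "cmod (F x t) \<le> g t" if "cmod (y - x) = r" for x
        using bound[of x t] sub that by (auto simp: dist_norm)
    qed (use r in auto)
    then show ?thesis by simp
  qed
  have "((\<lambda>y. ((\<integral>t. F y t \<partial>M) - (\<integral>t. F z t \<partial>M)) / (y - z)) \<longlongrightarrow> (\<integral>t. D t \<partial>M)) (at z within ball z r)"
    unfolding tendsto_at_iff_sequentially
  proof (intro allI impI)
    fix X assume X: "\<forall>i. X i \<in> ball z r - {z}" "X \<longlonglongrightarrow> z"
    have XS: "X i \<in> S" "X i \<noteq> z" "X i \<in> cball z r" for i using X(1) r by (auto dest!: spec[of _ i])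
    have q: "(\<lambda>i. (F (X i) t - F z t) / (X i - z)) \<longlonglongrightarrow> D t" for t
    proof -
      have "((\<lambda>y. (F y t - F z t) / (y - z)) \<longlongrightarrow> D t) (at z)"
        using der[OF z, of t] by (simp add: has_field_derivative_iff D_def)
      moreover have "filterlim X (at z) sequentially"
        using X(2) XS(2) by (simp add: filterlim_at)
      ultimately show ?thesis by (rule filterlim_compose)
    qed
    have "(\<lambda>i. \<integral>t. (F (X i) t - F z t) / (X i - z) \<partial>M) \<longlonglongrightarrow> (\<integral>t. D t \<partial>M)"
    proof (rule integral_dominated_convergence[where w = "\<lambda>t. g t / r"])
      show m: "(\<lambda>t. (F (X i) t - F z t) / (X i - z)) \<in> borel_measurable M" for i
        using meas[OF XS(1)[of i]] meas[OF z] by measurable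
      show "D \<in> borel_measurable M" by (rule borel_measurable_LIMSEQ_metric[OF m q])
      show "integrable M (\<lambda>t. g t / r)" using g by simp
      show "AE t in M. (\<lambda>i. (F (X i) t - F z t) / (X i - z)) \<longlonglongrightarrow> D t" using q by simp
      show "AE t in M. cmod ((F (X i) t - F z t) / (X i - z)) \<le> g t / r" for i
      proof (rule AE_I2)
        fix t
        have "cmod (F (X i) t - F z t) \<le> g t / r * cmod (X i - z)"
        proof (rule field_differentiable_bound[of "cball z r"])
          show "((\<lambda>y. F y t) has_field_derivative deriv (\<lambda>z. F z t) y) (at y within cball z r)"
            if "y \<in> cball z r" for y
            using that r by (intro has_field_derivative_at_within[OF der]) (auto simp: subset_iff)
        qed (use XS r db in auto)
        then show "cmod ((F (X i) t - F z t) / (X i - z)) \<le> g t / r"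
          using XS(2)[of i] r(1) by (simp add: norm_divide divide_simps)
      qed
    qed
    then show "((\<lambda>y. ((\<integral>t. F y t \<partial>M) - (\<integral>t. F z t \<partial>M)) / (y - z)) \<circ> X) \<longlonglongrightarrow> (\<integral>t. D t \<partial>M)"
      by (simp add: o_def Bochner_Integration.integral_diff[OF int[OF XS(1)] int[OF z]])
  qed
  then have "((\<lambda>y. ((\<integral>t. F y t \<partial>M) - (\<integral>t. F z t \<partial>M)) / (y - z)) \<longlongrightarrow> (\<integral>t. D t \<partial>M)) (at z)"
    using at_within_open[of z "ball z r"] r(1) by simp
  then show "\<exists>f'. ((\<lambda>z. \<integral>t. F z t \<partial>M) has_field_derivative f') (at z)"
    by (auto simp: has_field_derivative_iff)
qed

subsection \<open>The Jost function\<close>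

text \<open>Filling the removable singularity lets the Volterra kernel be holomorphic in
  \<open>k\<close> on a full disc around 0, although the equation itself is divided by
  \<open>k\<close>.\<close>

definition expm1_quot :: "complex \<Rightarrow> complex" where
  "expm1_quot z = (if z = 0 then 1 else (exp z - 1) / z)"

lemma expm1_quot_holomorphic: "expm1_quot holomorphic_on UNIV"
proof (rule no_isolated_singularity[where K = "{0}"])
  have "(expm1_quot \<longlongrightarrow> 1) (at 0)"
  proof -
    have "((\<lambda>z. (exp z - exp 0) / (z - 0)) \<longlongrightarrow> exp (0::complex)) (at 0)"
      using DERIV_exp[of "0::complex"] unfolding has_field_derivative_iff .
    then have "((\<lambda>z. (exp z - 1) / z) \<longlongrightarrow> (1::complex)) (at 0)" by simp
    then show ?thesis
      by (rule Lim_transform_eventually) (auto simp: expm1_quot_def eventually_at_filter)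
  qed
  then have "isCont expm1_quot 0" by (simp add: isCont_def expm1_quot_def)
  moreover have "isCont expm1_quot z" if "z \<noteq> 0" for z
  proof -
    have "isCont (\<lambda>z. (exp z - 1) / z :: complex) z" using that by (intro continuous_intros) auto
    moreover have "\<forall>\<^sub>F y in nhds z. expm1_quot y = (exp y - 1) / y"
      using that by (auto simp: expm1_quot_def intro: eventually_mono[OF t1_space_nhds])
    ultimately show ?thesis by (simp add: isCont_cong)
  qed
  ultimately show "continuous_on UNIV expm1_quot"
    by (metis continuous_at_imp_continuous_on)
  have "(\<lambda>z::complex. (exp z - 1) / z) holomorphic_on UNIV - {0}"
    by (intro holomorphic_intros) auto
  then show "expm1_quot holomorphic_on UNIV - {0}"
    by (rule holomorphic_transform) (auto simp: expm1_quot_def)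
qed auto

lemma norm_expm1_quot: "cmod (expm1_quot z) \<le> exp (cmod z)"
proof (cases "z = 0")
  case False
  have "cmod (exp z - exp 0) \<le> exp (cmod z) * cmod (z - 0)"
  proof (rule field_differentiable_bound[of "cball 0 (cmod z)"])
    show "cmod (exp y) \<le> exp (cmod z)" if "y \<in> cball 0 (cmod z)" for y
      using that complex_Re_le_cmod[of y] by simp
  qed (auto intro!: derivative_eq_intros)
  with False show ?thesis by (simp add: expm1_quot_def norm_divide divide_simps)
qed (simp add: expm1_quot_def)

lemma expm1_quot_measurable [measurable]: "expm1_quot \<in> borel_measurable borel"
  by (intro borel_measurable_continuous_onI holomorphic_on_imp_continuous_on expm1_quot_holomorphic)

text \<open>If \<open>F'' = V F - k^2 F\<close> and \<open>F = exp (i k x) M\<close>, then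
  \<open>M'' + 2 i k M' = V M\<close>. This is the kernel that solves the latter equation from plus
  infinity.\<close>

definition volterra_kernel :: "complex \<Rightarrow> real \<Rightarrow> complex" where
  "volterra_kernel k y = of_real y * expm1_quot (2 * \<i> * k * of_real y)"

lemma volterra_kernel_eq: "k \<noteq> 0 \<Longrightarrow> volterra_kernel k y = (exp (2 * \<i> * k * of_real y) - 1) / (2 * \<i> * k)"
  by (simp add: volterra_kernel_def expm1_quot_def)

lemma volterra_kernel_holomorphic: "(\<lambda>k. volterra_kernel k y) holomorphic_on S"
proof -
  have "(expm1_quot \<circ> (\<lambda>k. 2 * \<i> * k * of_real y)) holomorphic_on S"
    by (intro holomorphic_on_compose holomorphic_intros holomorphic_on_subset[OF expm1_quot_holomorphic]) auto
  then show ?thesis unfolding volterra_kernel_def by (auto simp: o_def intro!: holomorphic_intros)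
qed

lemma volterra_kernel_measurable [measurable]: "volterra_kernel k \<in> borel_measurable borel"
  unfolding volterra_kernel_def by measurable

lemma norm_volterra_kernel_upper_half_plane:
  assumes "k \<noteq> 0" "Im k \<ge> 0" "y \<ge> 0"
  shows "cmod (volterra_kernel k y) \<le> 1 / cmod k"
proof -
  have "cmod (exp (2 * \<i> * k * of_real y) - 1) \<le> cmod (exp (2 * \<i> * k * of_real y)) + 1"
    using norm_triangle_ineq4[of "exp (2 * \<i> * k * of_real y)" 1] by simp
  also have "\<dots> \<le> 2" using assms by (simp add: norm_exp_eq_Re)
  finally show ?thesis using assms
    by (simp add: volterra_kernel_eq norm_divide norm_mult divide_simps)
qed

text \<open>On the imaginary axis the exponential lies between 0 and 1, so the subtraction causes no
  loss. This gains a factor 2 over the bound for general \<open>k\<close>, which is what lets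
  \<open>\<kappa> = V_norm + 1\<close> suffice in \<open>jost_nonzero\<close>.\<close>

lemma norm_volterra_kernel_imaginary:
  assumes "\<kappa> > 0" "y \<ge> 0"
  shows "cmod (volterra_kernel (\<i> * of_real \<kappa>) y) \<le> 1 / (2 * \<kappa>)"
proof -
  have "volterra_kernel (\<i> * of_real \<kappa>) y = of_real ((1 - exp (- 2 * \<kappa> * y)) / (2 * \<kappa>))"
    using assms by (simp add: volterra_kernel_eq exp_of_real[symmetric] field_simps)
  moreover have "\<bar>(1 - exp (- 2 * \<kappa> * y)) / (2 * \<kappa>)\<bar> \<le> 1 / (2 * \<kappa>)"
    using assms by (simp add: divide_simps abs_le_iff)
  ultimately show ?thesis by (metis norm_of_real)
qed

section \<open>The weighted Volterra operator\<close>

locale super_exponential_potential =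
  fixes V :: "real \<Rightarrow> complex"
  assumes V_measurable [measurable]: "V \<in> borel_measurable borel"
    and exp_moment: "\<And>\<gamma>::real. integrable lborel (\<lambda>x. cmod (V x) * exp (\<gamma> * x))"
begin

definition "V_norm = (\<integral>x. cmod (V x) \<partial>lborel)"

lemma V_norm_nonneg: "V_norm \<ge> 0"
  by (simp add: V_norm_def)

lemma V_abs_integrable: "integrable lborel (\<lambda>x. cmod (V x))"
  using exp_moment[of 0] by simp

text \<open>One disc must contain both all candidates \<open>cmod k \<le> V_norm / 2\<close> and the
  point \<open>i * (V_norm + 1)\<close> at which the Jost function is shown not to vanish, so that
  the identity theorem connects them.\<close>

definition "radius = V_norm + 2"

text \<open>The rate is chosen so large that the Volterra operator below is a contraction with
  factor 1/2 for the weight, uniformly for \<open>k\<close> in the disc of the given radius.\<close>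

definition "rate = 2 * radius + 2 * (1 + V_norm)"

definition "moment = (\<integral>x. cmod (V x) * exp (rate * x) \<partial>lborel)"

text \<open>The summand 1 dominates bounded functions, in particular the start of the iteration. The
  exponential has the shape that the operator produces on the left, and its coefficient
  \<open>moment\<close> is what one application to the constant 1 yields. \<open>V\<close> remains
  integrable against this growth.\<close>

definition "weight x = 1 + moment * exp (- rate * x)"

lemma moment_nonneg: "moment \<ge> 0"
  by (simp add: moment_def)

lemma weight_ge_1: "weight x \<ge> 1"
  using moment_nonneg by (simp add: weight_def)

lemma V_weight_integrable: "integrable lborel (\<lambda>x. cmod (V x) * weight x)"
proof -
  have "integrable lborel (\<lambda>x. cmod (V x) + moment * (cmod (V x) * exp (- rate * x)))"
    by (intro Bochner_Integration.integrable_add integrable_mult_right V_abs_integrable exp_moment)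
  then show ?thesis by (simp add: weight_def algebra_simps)
qed

definition volterra :: "complex \<Rightarrow> (real \<Rightarrow> complex) \<Rightarrow> real \<Rightarrow> complex" where
  "volterra k u x = (\<integral>t. indicator {x..} t *\<^sub>R (volterra_kernel k (t - x) * (V t * u t)) \<partial>lborel)"

lemma volterra_measurable [measurable]:
  assumes [measurable]: "u \<in> borel_measurable borel"
  shows "volterra k u \<in> borel_measurable borel"
proof -
  have "(\<lambda>(x, t). (if x \<le> t then 1 else 0) *\<^sub>R (volterra_kernel k (t - x) * (V t * u t)))
      \<in> borel_measurable (borel \<Otimes>\<^sub>M lborel)" by measurable
  then have "(\<lambda>x. \<integral>t. (if x \<le> t then 1 else 0) *\<^sub>R (volterra_kernel k (t - x) * (V t * u t)) \<partial>lborel)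
      \<in> borel_measurable borel"
    by (rule lborel.borel_measurable_lebesgue_integral)
  then show ?thesis
    by (simp add: volterra_def[abs_def] indicator_def of_bool_def)
qed

text \<open>Independent of \<open>k\<close>, so it serves both as a bound and as the dominating
  function for holomorphy. Its integral contains \<open>moment * (1 + V_norm)\<close>, which the
  denominator reduces to the factor 1/2.\<close>

definition "majorant K x t =
  K * exp (- rate * x) / (2 * (1 + V_norm)) * (cmod (V t) * exp (rate * t) + moment * cmod (V t))"

lemma majorant_integrable: "integrable lborel (majorant K x)"
  unfolding majorant_def
  by (intro Bochner_Integration.integrable_add integrable_mult_right V_abs_integrable exp_moment)

lemma majorant_integral: "(\<integral>t. majorant K x t \<partial>lborel) = K / 2 * (moment * exp (- rate * x))"
proof -
  have "(\<integral>t. majorant K x t \<partial>lborel) =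
      K * exp (- rate * x) / (2 * (1 + V_norm)) * (moment + moment * V_norm)"
    unfolding majorant_def integral_mult_right_zero
    by (subst Bochner_Integration.integral_add)
       (use exp_moment V_abs_integrable in \<open>auto simp: moment_def V_norm_def\<close>)
  also have "moment + moment * V_norm = moment * (1 + V_norm)" by (simp add: algebra_simps)
  finally have eq: "(\<integral>t. majorant K x t \<partial>lborel) =
      K * exp (- rate * x) / (2 * (1 + V_norm)) * (moment * (1 + V_norm))" .
  have "K * e / (2 * q) * (moment * q) = K / 2 * (moment * e)" if "q \<noteq> 0" for e q
    using that by simp
  from this[of "1 + V_norm" "exp (- rate * x)"] show ?thesis
    unfolding eq using V_norm_nonneg by linarith
qed

lemma volterra_integrand_le:
  assumes k: "cmod k \<le> radius" and u: "cmod (u t) \<le> K * weight t" and K: "K \<ge> 0"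
  shows "cmod (indicator {x..} t *\<^sub>R (volterra_kernel k (t - x) * (V t * u t))) \<le> majorant K x t"
proof (cases "x \<le> t")
  case True
  define y where "y = t - x"
  have y: "y \<ge> 0" using True by (simp add: y_def)
  have "cmod (2 * \<i> * k * of_real y) \<le> 2 * radius * y"
    using k y by (simp add: norm_mult mult_right_mono)
  then have "cmod (expm1_quot (2 * \<i> * k * of_real y)) \<le> exp (2 * radius * y)"
    by (intro order_trans[OF norm_expm1_quot]) (simp only: exp_le_cancel_iff)
  then have "cmod (volterra_kernel k y) \<le> y * exp (2 * radius * y)"
    unfolding volterra_kernel_def norm_mult using y by (simp add: mult_left_mono)
  \<comment> \<open>With \<open>q = 2 * (1 + V_norm)\<close>, the linear growth of the kernel is
    absorbed by part of the exponential rate; the price paid in exponent buys the small factor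
    \<open>1 / q\<close>.\<close>
  also have "y * q \<le> exp (q * y)" for q
    using exp_ge_add_one_self[of "q * y"] by (subst mult.commute) linarith
  then have "y \<le> exp (2 * (1 + V_norm) * y) / (2 * (1 + V_norm))"
    using V_norm_nonneg by (simp add: pos_le_divide_eq)
  then have "y * exp (2 * radius * y) \<le> exp (2 * (1 + V_norm) * y) / (2 * (1 + V_norm)) * exp (2 * radius * y)"
    by (intro mult_right_mono) auto
  also have "\<dots> = exp (rate * y) / (2 * (1 + V_norm))"
    by (simp add: rate_def algebra_simps flip: exp_add)
  finally have kb: "cmod (volterra_kernel k y) \<le> exp (rate * y) / (2 * (1 + V_norm))" .
  have "cmod (volterra_kernel k y) * (cmod (V t) * cmod (u t)) \<le>
      exp (rate * y) / (2 * (1 + V_norm)) * (cmod (V t) * (K * weight t))"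
    using V_norm_nonneg by (intro mult_mono kb u) auto
  also have "\<dots> = majorant K x t"
  proof -
    have "exp (rate * y) = exp (rate * t) * exp (- rate * x)"
      by (simp add: y_def algebra_simps flip: exp_add)
    moreover have "exp (rate * t) * weight t = exp (rate * t) + moment"
      by (simp add: weight_def algebra_simps flip: exp_add)
    ultimately have "exp (rate * y) * weight t = exp (- rate * x) * (exp (rate * t) + moment)"
      by (metis mult.assoc mult.commute)
    then have "exp (rate * y) * weight t * K * cmod (V t) / (2 * (1 + V_norm)) =
      exp (- rate * x) * (exp (rate * t) + moment) * K * cmod (V t) / (2 * (1 + V_norm))" by simp
    then show ?thesis by (simp add: majorant_def algebra_simps)
  qed
  finally show ?thesis using True by (simp add: norm_mult y_def)
next
  case False
  then show ?thesis using K moment_nonneg V_norm_nonneg by (simp add: majorant_def)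
qed

lemma volterra_integrable:
  assumes k: "cmod k \<le> radius" and [measurable]: "u \<in> borel_measurable borel"
    and u: "\<And>t. cmod (u t) \<le> K * weight t" and K: "K \<ge> 0"
  shows "integrable lborel (\<lambda>t. indicator {x..} t *\<^sub>R (volterra_kernel k (t - x) * (V t * u t)))"
proof (rule Bochner_Integration.integrable_bound[OF majorant_integrable])
  show "AE t in lborel. cmod (indicator {x..} t *\<^sub>R (volterra_kernel k (t - x) * (V t * u t))) \<le> norm (majorant K x t)"
    unfolding real_norm_def
    by (intro AE_I2 order_trans[OF volterra_integrand_le abs_ge_self] k u K)
qed measurable

lemma norm_volterra_le:
  assumes k: "cmod k \<le> radius" and u: "\<And>t. cmod (u t) \<le> K * weight t" and K: "K \<ge> 0"
    and m: "u \<in> borel_measurable borel"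
  shows "cmod (volterra k u x) \<le> K / 2 * weight x"
proof -
  have "cmod (volterra k u x) \<le> (\<integral>t. majorant K x t \<partial>lborel)"
    unfolding volterra_def
    by (rule order_trans[OF integral_norm_bound integral_mono])
       (intro integrable_norm volterra_integrable[OF k m u K] majorant_integrable volterra_integrand_le k u K)+
  also have "\<dots> \<le> K / 2 * weight x"
    unfolding majorant_integral weight_def using K by (intro mult_left_mono) auto
  finally show ?thesis .
qed

lemma volterra_mult: "volterra k (\<lambda>t. a * u t) x = a * volterra k u x"
proof -
  have "volterra k (\<lambda>t. a * u t) x =
      (\<integral>t. a * (indicator {x..} t *\<^sub>R (volterra_kernel k (t - x) * (V t * u t))) \<partial>lborel)"
    unfolding volterra_def by (intro Bochner_Integration.integral_cong) (auto simp: mult_ac)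
  also have "\<dots> = a * volterra k u x" unfolding volterra_def by (rule integral_mult_right_zero)
  finally show ?thesis .
qed

lemma volterra_diff:
  assumes "cmod k \<le> radius" "K \<ge> 0"
    and "u \<in> borel_measurable borel" "\<And>t. cmod (u t) \<le> K * weight t"
    and "v \<in> borel_measurable borel" "\<And>t. cmod (v t) \<le> K * weight t"
  shows "volterra k (\<lambda>t. u t - v t) x = volterra k u x - volterra k v x"
proof -
  have "indicator {x..} t *\<^sub>R (volterra_kernel k (t - x) * (V t * (u t - v t))) =
      indicator {x..} t *\<^sub>R (volterra_kernel k (t - x) * (V t * u t)) -
      indicator {x..} t *\<^sub>R (volterra_kernel k (t - x) * (V t * v t))" for t
    by (simp add: right_diff_distrib scaleR_diff_right)
  then show ?thesis
    unfolding volterra_def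
    by (simp only: Bochner_Integration.integral_diff[OF volterra_integrable[OF assms(1,3,4,2)]
          volterra_integrable[OF assms(1,5,6,2)]])
qed

lemma volterra_power_bound:
  assumes k: "cmod k \<le> radius" and u: "u \<in> borel_measurable borel" "\<And>t. cmod (u t) \<le> K * weight t"
    and K: "K \<ge> 0"
  shows "(volterra k ^^ n) u \<in> borel_measurable borel"
    and "cmod ((volterra k ^^ n) u x) \<le> K * (1 / 2) ^ n * weight x"
proof (induction n arbitrary: x)
  case (Suc n)
  { case 1 then show ?case using Suc by simp }
  { case 2 then show ?case
      using norm_volterra_le[OF k Suc(2) _ Suc(1)] K by simp }
qed (use u in auto)

section \<open>The Volterra series and the Jost function\<close>

definition "jost_term k n = (volterra k ^^ n) (\<lambda>_. 1)"

lemma jost_term_measurable: "cmod k \<le> radius \<Longrightarrow> jost_term k n \<in> borel_measurable borel"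
  and norm_jost_term: "cmod k \<le> radius \<Longrightarrow> cmod (jost_term k n x) \<le> (1 / 2) ^ n * weight x"
  using volterra_power_bound[of k "\<lambda>_. 1" 1] weight_ge_1 by (auto simp: jost_term_def)

lemma jost_term_holomorphic: "(\<lambda>k. jost_term k n x) holomorphic_on ball 0 radius"
proof (induction n arbitrary: x)
  case (Suc n)
  have "(\<lambda>k. \<integral>t. indicator {x..} t *\<^sub>R (volterra_kernel k (t - x) * (V t * jost_term k n t)) \<partial>lborel)
      holomorphic_on ball 0 radius"
  proof (rule holomorphic_on_lebesgue_integral[where g = "majorant ((1 / 2) ^ n) x"])
    fix k :: complex assume "k \<in> ball 0 radius"
    then have k: "cmod k \<le> radius" by simp
    note [measurable] = jost_term_measurable[OF k]
    show "(\<lambda>t. indicator {x..} t *\<^sub>R (volterra_kernel k (t - x) * (V t * jost_term k n t))) \<in> borel_measurable lborel"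
      by measurable
    show "cmod (indicator {x..} t *\<^sub>R (volterra_kernel k (t - x) * (V t * jost_term k n t))) \<le> majorant ((1 / 2) ^ n) x t" for t
      by (intro volterra_integrand_le k norm_jost_term) auto
  next
    show "(\<lambda>k. indicator {x..} t *\<^sub>R (volterra_kernel k (t - x) * (V t * jost_term k n t))) holomorphic_on ball 0 radius" for t
      unfolding scaleR_conv_of_real by (intro holomorphic_intros volterra_kernel_holomorphic Suc)
  qed (auto intro: majorant_integrable)
  then show ?case by (simp add: jost_term_def volterra_def)
qed (simp add: jost_term_def)

definition "jost_coeff k n = (\<integral>t. V t * jost_term k n t \<partial>lborel)"

text \<open>Inserting the series for \<open>M\<close> into \<open>2ik A = \<integral> V M\<close>
  and cancelling \<open>A\<close> gives this expression, classically the Wronskian of the two Jost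
  solutions. Summing the integrals, rather than integrating the sum, keeps all limits at the level
  of numbers.\<close>

definition "jost k = 2 * \<i> * k - (\<Sum>n. jost_coeff k n)"

lemma V_mult_integrable:
  assumes [measurable]: "u \<in> borel_measurable borel" and u: "\<And>t. cmod (u t) \<le> K * weight t"
  shows "integrable lborel (\<lambda>t. V t * u t)"
    and "cmod (\<integral>t. V t * u t \<partial>lborel) \<le> K * (\<integral>t. cmod (V t) * weight t \<partial>lborel)"
proof -
  have b: "cmod (V t * u t) \<le> K * (cmod (V t) * weight t)" for t
    using mult_left_mono[OF u[of t], of "cmod (V t)"] by (simp add: norm_mult mult_ac)
  have i: "integrable lborel (\<lambda>t. K * (cmod (V t) * weight t))"
    by (intro integrable_mult_right V_weight_integrable)
  show I: "integrable lborel (\<lambda>t. V t * u t)"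
    by (rule Bochner_Integration.integrable_bound[OF i])
       (use b in \<open>auto intro: order_trans[OF _ abs_ge_self]\<close>)
  show "cmod (\<integral>t. V t * u t \<partial>lborel) \<le> K * (\<integral>t. cmod (V t) * weight t \<partial>lborel)"
    using order_trans[OF integral_norm_bound integral_mono[OF integrable_norm[OF I] i b]] by simp
qed

lemma norm_jost_coeff:
  assumes "cmod k \<le> radius"
  shows "cmod (jost_coeff k n) \<le> (1 / 2) ^ n * (\<integral>t. cmod (V t) * weight t \<partial>lborel)"
  unfolding jost_coeff_def
  by (intro V_mult_integrable jost_term_measurable norm_jost_term assms)

lemma summable_jost_bound: "summable (\<lambda>n. (1 / 2) ^ n * C :: real)"
  by (intro summable_mult2 summable_geometric) auto

lemma jost_holomorphic: "jost holomorphic_on ball 0 radius"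
proof -
  have coeff: "(\<lambda>k. jost_coeff k n) holomorphic_on ball 0 radius" for n
    unfolding jost_coeff_def
  proof (rule holomorphic_on_lebesgue_integral[where g = "\<lambda>t. (1 / 2) ^ n * (cmod (V t) * weight t)"])
    fix k :: complex assume "k \<in> ball 0 radius"
    then have k: "cmod k \<le> radius" by simp
    note [measurable] = jost_term_measurable[OF k]
    show "(\<lambda>t. V t * jost_term k n t) \<in> borel_measurable lborel" by measurable
    show "cmod (V t * jost_term k n t) \<le> (1 / 2) ^ n * (cmod (V t) * weight t)" for t
      using mult_left_mono[OF norm_jost_term[OF k, of n t], of "cmod (V t)"]
      by (simp add: norm_mult mult_ac)
  qed (auto intro!: holomorphic_intros jost_term_holomorphic integrable_mult_right V_weight_integrable)
  have "(\<lambda>k. \<Sum>n. jost_coeff k n) holomorphic_on ball 0 radius"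
  proof (rule holomorphic_uniform_sequence[where f = "\<lambda>n k. \<Sum>i<n. jost_coeff k i"])
    fix z :: complex assume "z \<in> ball 0 radius"
    then obtain d where d: "d > 0" "cball z d \<subseteq> ball 0 radius"
      using open_contains_cball open_ball by metis
    moreover have "uniform_limit (cball z d) (\<lambda>n k. \<Sum>i<n. jost_coeff k i) (\<lambda>k. \<Sum>n. jost_coeff k n) sequentially"
      using d(2) norm_jost_coeff
      by (intro Weierstrass_m_test[OF _ summable_jost_bound]) force
    ultimately show "\<exists>d>0. cball z d \<subseteq> ball 0 radius \<and>
        uniform_limit (cball z d) (\<lambda>n k. \<Sum>i<n. jost_coeff k i) (\<lambda>k. \<Sum>n. jost_coeff k n) sequentially"
      by blast
  qed (auto intro!: holomorphic_intros coeff)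
  then show ?thesis unfolding jost_def by (intro holomorphic_intros)
qed

text \<open>At \<open>k = i * \<kappa>\<close> with \<open>\<kappa> = V_norm + 1\<close>, each
  Volterra step gains 1/2 even in the unweighted supremum norm, so the series is at most
  \<open>2 * V_norm\<close>, which is below \<open>2 * \<kappa> = cmod (2 * i * k)\<close>. The
  terms are estimated afresh because the weighted integral of \<open>V\<close> has no direct
  comparison with \<open>\<kappa>\<close>.\<close>

lemma jost_nonzero: "jost (\<i> * of_real (V_norm + 1)) \<noteq> 0"
proof -
  define \<kappa> where "\<kappa> = V_norm + 1"
  define k where "k = \<i> * of_real \<kappa>"
  have \<kappa>: "\<kappa> > 0" using V_norm_nonneg by (simp add: \<kappa>_def)
  have k: "cmod k \<le> radius" using \<kappa> by (simp add: k_def radius_def norm_mult \<kappa>_def)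
  have term_le: "cmod (jost_term k n x) \<le> (1 / 2) ^ n" for n x
  proof (induction n arbitrary: x)
    case (Suc n)
    have "cmod (volterra k (jost_term k n) x) \<le> (\<integral>t. 1 / (2 * \<kappa>) * (1 / 2) ^ n * cmod (V t) \<partial>lborel)"
      unfolding volterra_def
    proof (rule order_trans[OF integral_norm_bound integral_mono])
      show "integrable lborel (\<lambda>t. cmod (indicator {x..} t *\<^sub>R (volterra_kernel k (t - x) * (V t * jost_term k n t))))"
        by (intro integrable_norm volterra_integrable[where K = "(1 / 2) ^ n"] k jost_term_measurable norm_jost_term) auto
      show "integrable lborel (\<lambda>t. 1 / (2 * \<kappa>) * (1 / 2) ^ n * cmod (V t))"
        by (intro integrable_mult_right V_abs_integrable)
      fix t
      show "cmod (indicator {x..} t *\<^sub>R (volterra_kernel k (t - x) * (V t * jost_term k n t)))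
          \<le> 1 / (2 * \<kappa>) * (1 / 2) ^ n * cmod (V t)"
      proof (cases "x \<le> t")
        case True
        have "cmod (volterra_kernel k (t - x)) * (cmod (V t) * cmod (jost_term k n t)) \<le>
            1 / (2 * \<kappa>) * (cmod (V t) * (1 / 2) ^ n)"
          using True \<kappa> unfolding k_def
          by (intro mult_mono norm_volterra_kernel_imaginary Suc[unfolded k_def] order_refl) auto
        then show ?thesis using True by (simp add: norm_mult mult_ac)
      qed (use \<kappa> in auto)
    qed
    also have "\<dots> = 1 / (2 * \<kappa>) * (1 / 2) ^ n * V_norm" by (simp add: V_norm_def)
    also have "\<dots> = (1 / 2) ^ Suc n * (V_norm / \<kappa>)" by simp
    also have "\<dots> \<le> (1 / 2) ^ Suc n * 1"
      using \<kappa> by (intro mult_left_mono) (auto simp: \<kappa>_def)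
    finally have "cmod (volterra k (jost_term k n) x) \<le> (1 / 2) ^ Suc n" by simp
    then show ?case by (simp add: jost_term_def)
  qed (simp add: jost_term_def)
  have coeff: "cmod (jost_coeff k n) \<le> (1 / 2) ^ n * V_norm" for n
  proof -
    have "cmod (jost_coeff k n) \<le> (\<integral>t. (1 / 2) ^ n * cmod (V t) \<partial>lborel)"
      unfolding jost_coeff_def
    proof (rule order_trans[OF integral_norm_bound integral_mono])
      show "integrable lborel (\<lambda>t. cmod (V t * jost_term k n t))"
        by (intro integrable_norm V_mult_integrable[where K = "(1 / 2) ^ n"] jost_term_measurable norm_jost_term k)
      show "cmod (V t * jost_term k n t) \<le> (1 / 2) ^ n * cmod (V t)" for t
        using mult_left_mono[OF term_le[of n t], of "cmod (V t)"] by (simp add: norm_mult mult_ac)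
    qed (intro integrable_mult_right V_abs_integrable)
    then show ?thesis by (simp add: V_norm_def)
  qed
  have "cmod (\<Sum>n. jost_coeff k n) \<le> (\<Sum>n. (1 / 2) ^ n * V_norm)"
    by (intro norm_suminf_le coeff summable_jost_bound)
  also have "\<dots> = 2 * V_norm"
    using suminf_geometric[of "1 / 2 :: real"] by (simp add: suminf_mult2[symmetric] summable_geometric)
  also have "\<dots> < 2 * \<kappa>" by (simp add: \<kappa>_def)
  also have "\<dots> = cmod (2 * \<i> * k)" using \<kappa> by (simp add: k_def norm_mult)
  finally have "(\<Sum>n. jost_coeff k n) \<noteq> 2 * \<i> * k" by auto
  then show ?thesis by (simp add: jost_def k_def \<kappa>_def)
qed

text \<open>A nonconstant holomorphic function has finitely many zeros in a compact subset of its
  connected domain. In the constant case, \<open>jost_nonzero\<close> excludes the constant 0 and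
  there are no zeros at all.\<close>

lemma finite_jost_zeros:
  assumes "r < radius"
  shows "finite {k \<in> cball 0 r. jost k = 0}"
proof (cases "jost constant_on ball 0 radius")
  case True
  have "\<i> * of_real (V_norm + 1) \<in> ball 0 radius"
    using V_norm_nonneg by (simp add: norm_mult radius_def)
  then have "jost k \<noteq> 0" if "k \<in> ball 0 radius" for k
    using True jost_nonzero that unfolding constant_on_def by metis
  then have "{k \<in> cball 0 r. jost k = 0} = {}" using assms by (auto simp: subset_iff)
  then show ?thesis by (simp only: finite.emptyI)
next
  case False
  then show ?thesis
    using assms by (intro holomorphic_compact_finite_zeros[OF jost_holomorphic]) auto
qed

text \<open>The iterates of \<open>M\<close> telescope: consecutive differences are \<open>A\<close>
  times the terms of the Volterra series, and the iterates tend to 0 in the weighted bound. Pairing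
  with \<open>V\<close> before summing produces a scalar telescoping series with sum
  \<open>\<integral> V M\<close>.\<close>

lemma jost_zero_if_homogeneous_solution:
  assumes k: "cmod k \<le> radius" and M: "M \<in> borel_measurable borel" "\<And>x. cmod (M x) \<le> K"
    and eq: "\<And>x. M x = A + volterra k M x" and A: "2 * \<i> * k * A = (\<integral>t. V t * M t \<partial>lborel)"
    and nz: "M x0 \<noteq> 0"
  shows "jost k = 0"
proof -
  let ?T = "volterra k"
  have K: "K \<ge> 0" using M(2)[of 0] norm_ge_zero order_trans by blast
  have Mw: "cmod (M t) \<le> K * weight t" for t
    using M(2)[of t] mult_left_mono[OF weight_ge_1[of t] K] by linarith
  note pow = volterra_power_bound[OF k M(1) Mw K]
  have step: "(?T ^^ n) M x - (?T ^^ Suc n) M x = A * jost_term k n x" for n x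
  proof (induction n arbitrary: x)
    case 0
    show ?case using eq[of x] by (simp add: jost_term_def)
  next
    case (Suc n)
    have b: "cmod ((?T ^^ n) M t) \<le> K * weight t" for n t
    proof -
      have "K * (1 / 2) ^ n * weight t \<le> K * 1 * weight t"
        using K weight_ge_1[of t] by (intro mult_right_mono mult_left_mono power_le_one) auto
      then show ?thesis using pow(2)[of n t] by linarith
    qed
    have "(?T ^^ Suc n) M x - (?T ^^ Suc (Suc n)) M x =
        ?T (\<lambda>t. (?T ^^ n) M t - (?T ^^ Suc n) M t) x"
      using volterra_diff[OF k K pow(1)[of n] b[of n] pow(1)[of "Suc n"] b[of "Suc n"]] by simp
    also have "\<dots> = A * jost_term k (Suc n) x"
      unfolding Suc volterra_mult by (simp add: jost_term_def)
    finally show ?case .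
  qed
  have lim0: "(\<lambda>n. K * (1 / 2) ^ n * C) \<longlonglongrightarrow> 0" for C
    using tendsto_mult[OF tendsto_mult[OF tendsto_const[of K] LIMSEQ_power_zero[of "1 / 2 :: real"]] tendsto_const[of C]]
    by simp
  \<comment> \<open>With \<open>A = 0\<close>, \<open>M\<close> would be a fixed point of a
    contraction and hence vanish.\<close>
  have "A \<noteq> 0"
  proof
    assume "A = 0"
    then have *: "(?T ^^ Suc n) M = (?T ^^ n) M" for n using step[of n] by (simp add: fun_eq_iff)
    have "(?T ^^ n) M = M" for n by (induction n) (simp_all only: * funpow_0)
    then have "cmod (M x0) \<le> K * (1 / 2) ^ n * weight x0" for n using pow(2)[of n x0] by simp
    then have "cmod (M x0) \<le> 0" by (intro LIMSEQ_le_const[OF lim0]) auto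
    with nz show False by simp
  qed
  define b where "b n = (\<integral>t. V t * (?T ^^ n) M t \<partial>lborel)" for n
  have b_diff: "b n - b (Suc n) = A * jost_coeff k n" for n
  proof -
    have "b n - b (Suc n) = (\<integral>t. V t * (?T ^^ n) M t - V t * (?T ^^ Suc n) M t \<partial>lborel)"
      unfolding b_def by (rule Bochner_Integration.integral_diff[symmetric]) (rule V_mult_integrable[OF pow])+
    also have "\<dots> = (\<integral>t. A * (V t * jost_term k n t) \<partial>lborel)"
      unfolding right_diff_distrib[symmetric] step by (simp add: mult_ac)
    finally show ?thesis by (simp add: jost_coeff_def)
  qed
  have "b \<longlonglongrightarrow> 0"
    by (rule Lim_null_comparison[OF _ lim0[of "\<integral>t. cmod (V t) * weight t \<partial>lborel"]])
       (use V_mult_integrable(2)[OF pow] in \<open>auto simp: b_def\<close>)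
  then have "(\<lambda>n. b n - b (Suc n)) sums (b 0 - 0)" by (rule telescope_sums')
  then have "(\<lambda>n. A * jost_coeff k n) sums (2 * \<i> * k * A)"
    by (simp only: b_diff) (simp add: b_def A)
  moreover have "summable (jost_coeff k)"
    by (rule summable_comparison_test'[OF summable_jost_bound norm_jost_coeff[OF k]])
  then have "(\<lambda>n. A * jost_coeff k n) sums (A * (\<Sum>n. jost_coeff k n))"
    by (intro sums_mult summable_sums)
  ultimately have "2 * \<i> * k * A = A * (\<Sum>n. jost_coeff k n)" by (rule sums_unique2)
  with \<open>A \<noteq> 0\<close> show ?thesis by (simp add: jost_def mult.assoc)
qed

end

section \<open>Solutions of the integral equation are zeros of the Jost function\<close>

context super_exponential_potential
begin

text \<open>Integrability of \<open>V * F\<close> already bounds \<open>F\<close> by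
  \<open>C\<close>. Feeding a bound back into the equation multiplies it by
  \<open>q = V_norm / (2 * cmod k)\<close>, so \<open>q < 1\<close> would force
  \<open>F = 0\<close>. For the second claim the difficulty is that \<open>M\<close> may exceed
  \<open>F\<close> by the growing factor \<open>exp (Im k * x)\<close>; its boundedness has to be
  obtained from the Volterra equation.\<close>

lemma integral_equation_solution:
  fixes F :: "real \<Rightarrow> complex"
  assumes k: "Im k \<ge> 0" "k \<noteq> 0" and F [measurable]: "F \<in> borel_measurable borel"
    and w: "integrable lborel (\<lambda>s. V s * F s)"
    and eq: "\<And>x. 2 * \<i> * k * F x = (\<integral>s. exp (\<i> * k * of_real \<bar>x - s\<bar>) * (V s * F s) \<partial>lborel)"
    and nz: "F x0 \<noteq> 0"
  shows "cmod k \<le> V_norm / 2" and "jost k = 0"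
proof -
  have exp_le: "cmod (exp (\<i> * k * of_real \<bar>x - s\<bar>) * (V s * F s)) \<le> cmod (V s * F s)" for x s
    using norm_exp_abs_le[OF k(1), of "x - s"]
    by (subst norm_mult) (intro mult_left_le_one_le, auto)
  have norm_eq: "2 * cmod k * cmod (F x) \<le> (\<integral>s. cmod (V s * F s) \<partial>lborel)" for x
  proof -
    have "2 * cmod k * cmod (F x) = cmod (2 * \<i> * k * F x)" by (simp add: norm_mult)
    also have "\<dots> \<le> (\<integral>s. cmod (exp (\<i> * k * of_real \<bar>x - s\<bar>) * (V s * F s)) \<partial>lborel)"
      unfolding eq by (rule integral_norm_bound)
    also have "\<dots> \<le> (\<integral>s. cmod (V s * F s) \<partial>lborel)"
      by (intro integral_mono integrable_norm integrable_exp_abs w k exp_le)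
    finally show ?thesis .
  qed
  define C where "C = (\<integral>s. cmod (V s * F s) \<partial>lborel) / (2 * cmod k)"
  have C: "C \<ge> 0" using k by (simp add: C_def)
  have FC: "cmod (F x) \<le> C" for x
    using norm_eq[of x] k(2) by (simp add: C_def pos_le_divide_eq mult.commute)
  define q where "q = V_norm / (2 * cmod k)"
  have q0: "q \<ge> 0" using V_norm_nonneg by (simp add: q_def)
  have Fq: "cmod (F x) \<le> q ^ n * C" for n x
  proof (induction n arbitrary: x)
    case (Suc n)
    have "2 * cmod k * cmod (F x) \<le> (\<integral>s. cmod (V s * F s) \<partial>lborel)" by (rule norm_eq)
    also have "\<dots> \<le> (\<integral>s. q ^ n * C * cmod (V s) \<partial>lborel)"
    proof (rule integral_mono)
      show "integrable lborel (\<lambda>s. cmod (V s * F s))" by (rule integrable_norm[OF w])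
      show "integrable lborel (\<lambda>s. q ^ n * C * cmod (V s))"
        by (intro integrable_mult_right V_abs_integrable)
      show "cmod (V s * F s) \<le> q ^ n * C * cmod (V s)" for s
        using mult_left_mono[OF Suc[of s], of "cmod (V s)"] by (simp add: norm_mult mult_ac)
    qed
    also have "\<dots> = 2 * cmod k * (q ^ Suc n * C)"
      using k(2) by (simp add: V_norm_def q_def)
    finally show ?case using k(2) by simp
  qed (use FC in simp)
  show kV: "cmod k \<le> V_norm / 2"
  proof (rule ccontr)
    assume "\<not> cmod k \<le> V_norm / 2"
    then have "q < 1" using k(2) by (simp add: q_def)
    then have "(\<lambda>n. q ^ n * C) \<longlonglongrightarrow> 0 * C"
      using q0 by (intro tendsto_intros LIMSEQ_power_zero) simp
    then have "cmod (F x0) \<le> 0 * C" by (rule LIMSEQ_le_const) (use Fq in auto)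
    with nz show False by simp
  qed
  define M where "M x = exp (- \<i> * k * of_real x) * F x" for x
  have [measurable]: "M \<in> borel_measurable borel" unfolding M_def by measurable
  \<comment> \<open>This is where the growth of \<open>M\<close> at plus infinity is met by an
    exponential moment of \<open>V\<close>.\<close>
  have VM: "integrable lborel (\<lambda>t. V t * M t)"
  proof (rule Bochner_Integration.integrable_bound)
    show "integrable lborel (\<lambda>t. C * (cmod (V t) * exp (Im k * t)))"
      by (intro integrable_mult_right exp_moment)
    show "AE t in lborel. cmod (V t * M t) \<le> norm (C * (cmod (V t) * exp (Im k * t)))"
    proof (rule AE_I2)
      fix t
      have "cmod (V t * M t) = cmod (V t) * exp (Im k * t) * cmod (F t)"
        by (simp add: M_def norm_mult norm_exp_eq_Re)
      also have "\<dots> \<le> cmod (V t) * exp (Im k * t) * C" by (intro mult_left_mono FC) auto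
      finally show "cmod (V t * M t) \<le> norm (C * (cmod (V t) * exp (Im k * t)))"
        using C by (simp add: mult_ac)
    qed
  qed measurable
  define A where "A = (\<integral>t. V t * M t \<partial>lborel) / (2 * \<i> * k)"
  let ?i = "\<lambda>x t. indicator {x..} t *\<^sub>R (volterra_kernel k (t - x) * (V t * M t))"
  have i_le: "cmod (?i x t) \<le> 1 / cmod k * cmod (V t * M t)" for x t
  proof (cases "x \<le> t")
    case True
    then show ?thesis
      using mult_right_mono[OF norm_volterra_kernel_upper_half_plane[OF k(2,1), of "t - x"], of "cmod (V t * M t)"]
      by (simp add: norm_mult)
  qed simp
  have i_int: "integrable lborel (?i x)" for x
  proof (rule Bochner_Integration.integrable_bound)
    show "integrable lborel (\<lambda>t. 1 / cmod k * cmod (V t * M t))"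
      by (intro integrable_mult_right integrable_norm VM)
    show "AE t in lborel. cmod (?i x t) \<le> norm (1 / cmod k * cmod (V t * M t))"
      by (intro AE_I2 order_trans[OF i_le]) simp
  qed measurable
  have M_eq: "M x = A + volterra k M x" for x
  proof -
    \<comment> \<open>The three exponentials combine to 1 for \<open>t < x\<close> and to
      \<open>exp (2 * i * k * (t - x))\<close> for \<open>t \<ge> x\<close>. Hence the full-line
      kernel is the constant 1, which yields \<open>A\<close>, plus \<open>2ik\<close> times the
      Volterra kernel.\<close>
    have pt: "exp (- \<i> * k * of_real x) * (exp (\<i> * k * of_real \<bar>x - t\<bar>) * (V t * F t)) =
        V t * M t + 2 * \<i> * k * ?i x t" for t
    proof -
      have F_eq: "F t = exp (\<i> * k * of_real t) * M t"
        by (simp add: M_def flip: exp_add mult.assoc)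
      show ?thesis
      proof (cases "x \<le> t")
        case True
        have "exp (- \<i> * k * of_real x) * (exp (\<i> * k * of_real \<bar>x - t\<bar>) * exp (\<i> * k * of_real t)) =
            exp (2 * \<i> * k * of_real (t - x))"
          using True by (simp add: algebra_simps flip: exp_add)
        moreover have "exp (2 * \<i> * k * of_real (t - x)) = 1 + 2 * \<i> * k * volterra_kernel k (t - x)"
          using k(2) by (simp add: volterra_kernel_eq)
        ultimately have e: "exp (- \<i> * k * of_real x) * (exp (\<i> * k * of_real \<bar>x - t\<bar>) * exp (\<i> * k * of_real t)) =
            1 + 2 * \<i> * k * volterra_kernel k (t - x)" by simp
        have "exp (- \<i> * k * of_real x) * (exp (\<i> * k * of_real \<bar>x - t\<bar>) * (V t * F t)) =
            (exp (- \<i> * k * of_real x) * (exp (\<i> * k * of_real \<bar>x - t\<bar>) * exp (\<i> * k * of_real t))) * (V t * M t)"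
          unfolding F_eq by (simp only: mult_ac)
        also have "\<dots> = V t * M t + 2 * \<i> * k * ?i x t"
          unfolding e using True by (simp add: algebra_simps)
        finally show ?thesis .
      next
        case False
        have e: "exp (- \<i> * k * of_real x) * (exp (\<i> * k * of_real \<bar>x - t\<bar>) * exp (\<i> * k * of_real t)) = 1"
          using False by (simp add: algebra_simps flip: exp_add)
        have "exp (- \<i> * k * of_real x) * (exp (\<i> * k * of_real \<bar>x - t\<bar>) * (V t * F t)) =
            (exp (- \<i> * k * of_real x) * (exp (\<i> * k * of_real \<bar>x - t\<bar>) * exp (\<i> * k * of_real t))) * (V t * M t)"
          unfolding F_eq by (simp only: mult_ac)
        also have "\<dots> = V t * M t + 2 * \<i> * k * ?i x t"
          unfolding e using False by simp
        finally show ?thesis .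
      qed
    qed
    have "2 * \<i> * k * M x = exp (- \<i> * k * of_real x) * (2 * \<i> * k * F x)"
      by (simp add: M_def mult_ac)
    also have "\<dots> = (\<integral>t. exp (- \<i> * k * of_real x) * (exp (\<i> * k * of_real \<bar>x - t\<bar>) * (V t * F t)) \<partial>lborel)"
      unfolding eq by (rule integral_mult_right_zero[symmetric])
    also have "\<dots> = (\<integral>t. V t * M t \<partial>lborel) + 2 * \<i> * k * volterra k M x"
      unfolding pt volterra_def
      by (subst Bochner_Integration.integral_add) (use VM i_int in \<open>auto simp del: mult_scaleR_right\<close>)
    finally show ?thesis using k(2) by (simp add: A_def field_simps)
  qed
  \<comment> \<open>For \<open>Im k \<ge> 0\<close> and \<open>t \<ge> x\<close> the Volterra kernel
    is at most \<open>1 / cmod k\<close>, so integrability of \<open>V * M\<close> now gives a bound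
    uniform in \<open>x\<close>.\<close>
  have "cmod (M x) \<le> cmod A + (\<integral>t. 1 / cmod k * cmod (V t * M t) \<partial>lborel)" for x
  proof -
    have "cmod (volterra k M x) \<le> (\<integral>t. 1 / cmod k * cmod (V t * M t) \<partial>lborel)"
      unfolding volterra_def
      by (rule order_trans[OF integral_norm_bound integral_mono])
         (intro integrable_norm i_int integrable_mult_right VM i_le)+
    then show ?thesis using M_eq[of x] norm_triangle_ineq[of A "volterra k M x"] by simp
  qed
  note M_bound = this
  have k_radius: "cmod k \<le> radius" using kV V_norm_nonneg by (simp add: radius_def)
  have "2 * \<i> * k * A = (\<integral>t. V t * M t \<partial>lborel)" using k(2) by (simp add: A_def)
  moreover have "M x0 \<noteq> 0" using nz by (simp add: M_def)
  moreover have "M \<in> borel_measurable borel" by measurable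
  ultimately show "jost k = 0"
    using jost_zero_if_homogeneous_solution[OF k_radius _ M_bound M_eq] by metis
qed

end

subsection \<open>Reduction to Borel representatives\<close>

text \<open>The analysis takes place over \<open>lborel\<close>, where Fubini and integrals
  depending on a parameter are available; eigenfunctions and potentials are only Lebesgue
  measurable, so Borel representatives take their place.\<close>

lemma lebesgue_measurable_complex_representative:
  fixes g :: "real \<Rightarrow> complex"
  assumes [measurable]: "g \<in> borel_measurable lebesgue"
  obtains g' where "g' \<in> borel_measurable borel" "AE x in lebesgue. g x = g' x"
proof -
  have "(\<lambda>x. Re (g x)) \<in> borel_measurable lebesgue" "(\<lambda>x. Im (g x)) \<in> borel_measurable lebesgue"
    by measurable
  from completion_ex_borel_measurable_real[OF this(1)] completion_ex_borel_measurable_real[OF this(2)]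
  obtain a b where ab: "a \<in> borel_measurable borel" "b \<in> borel_measurable borel"
    and ae: "AE x in lborel. Re (g x) = a x" "AE x in lborel. Im (g x) = b x" by auto
  have "AE x in lborel. g x = Complex (a x) (b x)"
    using ae by eventually_elim (auto simp: complex_eq_iff)
  then have "AE x in lebesgue. g x = Complex (a x) (b x)" by (rule AE_completion)
  moreover have "(\<lambda>x. Complex (a x) (b x)) \<in> borel_measurable borel"
    using ab by (simp add: Complex_eq)
  ultimately show ?thesis using that by blast
qed

lemma lebesgue_integral_borel_representative:
  fixes g :: "real \<Rightarrow> 'a::{banach, second_countable_topology}"
  assumes g: "g \<in> borel_measurable lebesgue" and g': "g' \<in> borel_measurable borel"
    and ae: "AE x in lebesgue. g x = g' x"
  shows "(\<integral>x. g x \<partial>lebesgue) = (\<integral>x. g' x \<partial>lborel)"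
    and "integrable lebesgue g \<longleftrightarrow> integrable lborel g'"
proof -
  have g'': "g' \<in> borel_measurable lborel" using g' by simp
  have gl: "g' \<in> borel_measurable lebesgue" using g'' by (rule measurable_completion)
  show "(\<integral>x. g x \<partial>lebesgue) = (\<integral>x. g' x \<partial>lborel)"
    using integral_cong_AE[OF g gl ae] integral_completion[OF g''] by simp
  show "integrable lebesgue g \<longleftrightarrow> integrable lborel g'"
    using integrable_cong_AE[OF g gl ae] integrable_completion[OF g''] by simp
qed

text \<open>Local integrability gives measurability on the compact support of \<open>\<phi>\<close>,
  and the product vanishes elsewhere.\<close>

lemma locally_integrable_times_test_measurable:
  assumes g: "locally_integrable g" and \<phi>: "test_function \<phi>"
  shows "(\<lambda>x. g x * of_real (\<phi> x)) \<in> borel_measurable lebesgue"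
proof -
  let ?K = "closure {x. \<phi> x \<noteq> 0}"
  have "\<phi> \<in> borel_measurable lborel" using test_function_measurable[OF \<phi>] by simp
  then have [measurable]: "\<phi> \<in> borel_measurable lebesgue" by (rule measurable_completion)
  have "set_integrable lebesgue ?K g"
    using g \<phi> by (simp add: locally_integrable_def test_function_def)
  then have [measurable]: "(\<lambda>x. indicator ?K x *\<^sub>R g x) \<in> borel_measurable lebesgue"
    unfolding set_integrable_def by (rule borel_measurable_integrable)
  have "(\<lambda>x. indicator ?K x *\<^sub>R g x * of_real (\<phi> x)) \<in> borel_measurable lebesgue"
    by measurable
  also have "(\<lambda>x. indicator ?K x *\<^sub>R g x * of_real (\<phi> x)) = (\<lambda>x. g x * of_real (\<phi> x))"
    using closure_subset[of "{x. \<phi> x \<noteq> 0}"] by (force simp: indicator_def fun_eq_iff)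
  finally show ?thesis .
qed

lemma sqrt_in_upper_half_plane:
  obtains k where "k\<^sup>2 = z" "Im k \<ge> 0"
proof (cases "Im (csqrt z) \<ge> 0")
  case False
  then show ?thesis using that[of "- csqrt z"] by simp
qed (use that[of "csqrt z"] in simp)

lemma (in super_exponential_potential) eigenvalue_imp_jost_zero:
  fixes U :: "real \<Rightarrow> complex"
  assumes U: "U \<in> L2_space" and UV: "AE x in lebesgue. U x = V x"
    and z: "z \<in> eigenvalues (W2_space 2) (schrodinger U)" "z \<noteq> 0"
  shows "\<exists>k. z = k\<^sup>2 \<and> cmod k \<le> V_norm / 2 \<and> jost k = 0"
proof -
  obtain k where k: "k\<^sup>2 = z" "Im k \<ge> 0" by (rule sqrt_in_upper_half_plane)
  have k0: "k \<noteq> 0" using k z(2) by auto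
  obtain f where f: "f \<in> W2_space 2" "\<not> (AE x in lebesgue. f x = 0)"
    and ev: "AE x in lebesgue. schrodinger U f x = z * f x"
    using z(1) unfolding eigenvalues_def by blast
  define g where "g = weak_deriv 2 f"
  have wd: "has_weak_deriv 2 f g"
  proof -
    have "\<exists>g. has_weak_deriv 2 f g" using f(1) unfolding W2_space_def by blast
    then show ?thesis unfolding g_def weak_deriv_def by (rule someI_ex)
  qed
  have f_meas [measurable]: "f \<in> borel_measurable lebesgue"
    and f_sq: "integrable lebesgue (\<lambda>x. (cmod (f x))\<^sup>2)"
    using f(1) by (auto simp: W2_space_def L2_space_def)
  have U_meas [measurable]: "U \<in> borel_measurable lebesgue"
    and U_sq: "integrable lebesgue (\<lambda>x. (cmod (U x))\<^sup>2)"
    using U by (auto simp: L2_space_def)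
  obtain h where h [measurable]: "h \<in> borel_measurable borel" and fh: "AE x in lebesgue. f x = h x"
    using lebesgue_measurable_complex_representative[OF f_meas] by blast
  define w where "w x = V x * h x" for x
  have [measurable]: "w \<in> borel_measurable borel" unfolding w_def by measurable
  have h_sq: "integrable lborel (\<lambda>x. (cmod (h x))\<^sup>2)"
    using f_sq fh by (subst lebesgue_integral_borel_representative(2)[symmetric, where g = "\<lambda>x. (cmod (f x))\<^sup>2"]) auto
  have V_sq: "integrable lborel (\<lambda>x. (cmod (V x))\<^sup>2)"
    using U_sq UV by (subst lebesgue_integral_borel_representative(2)[symmetric, where g = "\<lambda>x. (cmod (U x))\<^sup>2"]) auto
  \<comment> \<open>The product of two square-integrable functions is integrable; the assumption
    that \<open>V\<close> lies in \<open>L^2\<close> enters here.\<close>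
  have w_int: "integrable lborel w"
  proof (rule Bochner_Integration.integrable_bound)
    show "integrable lborel (\<lambda>x. (cmod (V x))\<^sup>2 + (cmod (h x))\<^sup>2)"
      by (intro Bochner_Integration.integrable_add V_sq h_sq)
    have "a * b \<le> a\<^sup>2 + b\<^sup>2" if "a \<ge> 0" "b \<ge> 0" for a b :: real
      using sum_squares_bound[of a b] that mult_nonneg_nonneg[of a b] by linarith
    then show "AE x in lborel. cmod (w x) \<le> norm ((cmod (V x))\<^sup>2 + (cmod (h x))\<^sup>2)"
      by (intro AE_I2) (simp add: w_def norm_mult)
  qed measurable
  have g_eq: "AE x in lebesgue. g x = w x - k\<^sup>2 * h x"
    using ev fh UV
  proof eventually_elim
    case (elim x)
    then have "- g x + V x * h x = z * h x" by (simp add: schrodinger_def g_def)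
    then show ?case by (simp add: w_def k(1) algebra_simps)
  qed
  have "AE x in lborel. 2 * \<i> * k * h x = (\<integral>s. exp (\<i> * k * of_real \<bar>x - s\<bar>) * w s \<partial>lborel)"
  proof (rule weak_solution_integral_equation[OF h h_sq w_int k(2)])
    fix \<phi> assume \<phi>: "test_function \<phi>"
    have \<phi>2: "test_function ((deriv ^^ 2) \<phi>)"
      by (simp add: numeral_2_eq_2 test_function_deriv \<phi>)
    note [measurable] = test_function_measurable[OF \<phi>] test_function_measurable[OF \<phi>2]
    have lf: "locally_integrable f" and lg: "locally_integrable g"
      using wd by (auto simp: has_weak_deriv_def)
    have "(\<integral>x. h x * of_real ((deriv ^^ 2) \<phi> x) \<partial>lborel) = (\<integral>x. f x * of_real ((deriv ^^ 2) \<phi> x) \<partial>lebesgue)"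
      using fh by (intro lebesgue_integral_borel_representative(1)[symmetric]
          locally_integrable_times_test_measurable lf \<phi>2) auto
    also have "\<dots> = (-1) ^ 2 * (\<integral>x. g x * of_real (\<phi> x) \<partial>lebesgue)"
      using wd \<phi> unfolding has_weak_deriv_def by blast
    also have "\<dots> = (\<integral>x. g x * of_real (\<phi> x) \<partial>lebesgue)" by simp
    also have "\<dots> = (\<integral>x. (w x - k\<^sup>2 * h x) * of_real (\<phi> x) \<partial>lborel)"
      using g_eq by (intro lebesgue_integral_borel_representative(1)
          locally_integrable_times_test_measurable lg \<phi>) auto
    finally show "(\<integral>x. h x * of_real ((deriv ^^ 2) \<phi> x) \<partial>lborel) =
        (\<integral>x. (w x - k\<^sup>2 * h x) * of_real (\<phi> x) \<partial>lborel)" .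
  qed
  \<comment> \<open>The integral formula is used as the definition of a representative of the
    eigenfunction. The equation then holds at every point, as the pointwise estimates for
    \<open>F\<close> demand.\<close>
  moreover define F where "F x = (\<integral>s. exp (\<i> * k * of_real \<bar>x - s\<bar>) * w s \<partial>lborel) / (2 * \<i> * k)" for x
  ultimately have hF: "AE x in lborel. h x = F x"
    using k0 by (auto elim!: eventually_mono simp: F_def field_simps)
  have [measurable]: "F \<in> borel_measurable borel" unfolding F_def by measurable
  have wF: "AE x in lborel. w x = V x * F x"
    using hF by eventually_elim (simp add: w_def)
  have VF: "integrable lborel (\<lambda>x. V x * F x)"
    using w_int wF by (subst integrable_cong_AE[symmetric, of w]) auto
  have F_eq: "2 * \<i> * k * F x = (\<integral>s. exp (\<i> * k * of_real \<bar>x - s\<bar>) * (V s * F s) \<partial>lborel)" for x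
  proof -
    have "2 * \<i> * k * F x = (\<integral>s. exp (\<i> * k * of_real \<bar>x - s\<bar>) * w s \<partial>lborel)"
      using k0 by (simp add: F_def)
    also have "\<dots> = (\<integral>s. exp (\<i> * k * of_real \<bar>x - s\<bar>) * (V s * F s) \<partial>lborel)"
      using wF by (intro integral_cong_AE) (auto elim: eventually_mono)
    finally show ?thesis .
  qed
  have "\<exists>x0. F x0 \<noteq> 0"
  proof (rule ccontr)
    assume "\<nexists>x0. F x0 \<noteq> 0"
    then have "AE x in lborel. h x = 0" using hF by simp
    then have "AE x in lebesgue. h x = 0" by (rule AE_completion)
    with fh have "AE x in lebesgue. f x = 0" by eventually_elim simp
    with f(2) show False by simp
  qed
  then obtain x0 where "F x0 \<noteq> 0" by blast
  from integral_equation_solution[OF k(2) k0 _ VF F_eq this] k(1) show ?thesis by auto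
qed

theorem theorem5:
  fixes V :: "real \<Rightarrow> complex"
  assumes "V \<in> L1_space \<inter> L2_space"
    and "\<And>\<gamma>::real. integrable lebesgue (\<lambda>x. cmod (V x) * exp (\<gamma> * x))"
  shows "finite (eigenvalues (W2_space 2) (schrodinger V)) \<and>
         (\<forall>z \<in> eigenvalues (W2_space 2) (schrodinger V). cmod z \<le> 9 / 4 * (L1_norm V)\<^sup>2)"
proof -
  have V_meas [measurable]: "V \<in> borel_measurable lebesgue" and V2: "V \<in> L2_space"
    using assms(1) by (auto simp: L2_space_def)
  obtain W where W [measurable]: "W \<in> borel_measurable borel" and VW: "AE x in lebesgue. V x = W x"
    using lebesgue_measurable_complex_representative[OF V_meas] by blast
  interpret super_exponential_potential W
  proof
    fix \<gamma> :: real
    have "(\<lambda>x. exp (\<gamma> * x)) \<in> borel_measurable lborel" by measurable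
    then have [measurable]: "(\<lambda>x. exp (\<gamma> * x)) \<in> borel_measurable lebesgue" by (rule measurable_completion)
    show "integrable lborel (\<lambda>x. cmod (W x) * exp (\<gamma> * x))"
      using assms(2)[of \<gamma>] VW
      by (subst lebesgue_integral_borel_representative(2)[symmetric, where g = "\<lambda>x. cmod (V x) * exp (\<gamma> * x)"]) auto
  qed (rule W)
  have L1: "L1_norm V = V_norm"
    unfolding L1_norm_def V_norm_def
    using VW by (intro lebesgue_integral_borel_representative(1)) auto
  define Z where "Z = {k \<in> cball 0 (V_norm / 2). jost k = 0}"
  have Z: "\<exists>k\<in>Z. z = k\<^sup>2" if "z \<in> eigenvalues (W2_space 2) (schrodinger V)" "z \<noteq> 0" for z
    using eigenvalue_imp_jost_zero[OF V2 VW that] by (auto simp: Z_def)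
  have "finite Z"
    unfolding Z_def using V_norm_nonneg by (intro finite_jost_zeros) (simp add: radius_def)
  \<comment> \<open>The point 0 is inserted by hand, whether or not it is an eigenvalue, because the
    passage to Jost zeros divides by \<open>k\<close>.\<close>
  then have "finite (insert 0 ((\<lambda>k. k\<^sup>2) ` Z))" by simp
  moreover have "eigenvalues (W2_space 2) (schrodinger V) \<subseteq> insert 0 ((\<lambda>k. k\<^sup>2) ` Z)"
    using Z by blast
  ultimately have "finite (eigenvalues (W2_space 2) (schrodinger V))" by (rule rev_finite_subset)
  moreover have "cmod z \<le> 9 / 4 * (L1_norm V)\<^sup>2" if "z \<in> eigenvalues (W2_space 2) (schrodinger V)" for z
  proof (cases "z = 0")
    case False
    with Z[OF that] obtain k where k: "z = k\<^sup>2" "cmod k \<le> V_norm / 2" by (auto simp: Z_def)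
    have "cmod z \<le> (V_norm / 2)\<^sup>2" unfolding k(1) norm_power using k(2) by (intro power_mono) auto
    also have "\<dots> \<le> 9 / 4 * V_norm\<^sup>2" by (simp add: power_divide)
    finally show ?thesis by (simp add: L1)
  qed simp
  ultimately show ?thesis by blast
qed

end
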